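(* Let $A=(a_{nk})_{n,k\in\mathbb N_0}$ be an infinite real matrix, let $1\le p\le\infty$, and let $q$ be the conjugate exponent of $p$ ($q=\infty$ if $p=1$, $q=1$ if $p=\infty$). Put $$\widehat a_{nk}=\lambda_k\left\{\frac{f_{k+1}^2a_{nk}}{(\lambda_k-\lambda_{k-1})f_kf_{k+1}}+\left[\frac1{(\lambda_k-\lambda_{k-1})f_kf_{k+1}}-\frac1{(\lambda_{k+1}-\lambda_k)f_{k+1}f_{k+2}}\right]\sum_{j=k+1}^\infty f_{j+1}^2a_{nj}\right\},$$ $\widehat A_n=(\widehat a_{nk})_{k\in\mathbb N_0}$, and $\mathbb N_r=\{n\in\mathbb N_0:n\ge r\}$. Let $L_A$ denote the operator $x\mapsto Ax$ and $\|L_A\|_\chi$ its Hausdorff measure of non-compactness. (a) If $A\in(\ell_p^{\lambda}(\widehat F):c_0)$, then $$\|L_A\|_\chi=\begin{cases}\lim_{r\to\infty}\big(\sup_{n\in\mathbb N_r}\sum_k|\widehat a_{nk}|\big),&p=\infty,\\ \lim_{r\to\infty}\big(\sup_{n\in\mathbb N_r}(\sum_k|\widehat a_{nk}|^q)^{1/q}\big),&1<p<\infty,\\ \lim_{r\to\infty}\big(\sup_{n\ge r,\,k\ge0}|\widehat a_{nk}|\big),&p=1.\end{cases}$$ (b) If $A\in(\ell_p^{\lambda}(\widehat F):\ell_1)$ with $1<p\le\infty$, then $$\lim_{r\to\infty}\Big(\sup_{N}\Big\|\sum_{n\in N}\widehat A_n\Big\|_q\Big)\le\|L_A\|_\chi\le4\lim_{r\to\infty}\Big(\sup_{N}\Big\|\sum_{n\in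 N}\widehat A_n\Big\|_q\Big),$$ where for each $r$ the supremum is over all finite subsets $N$ of $\mathbb N_r$. If $A\in(\ell_1^{\lambda}(\widehat F):\ell_1)$, then $$\|L_A\|_\chi=\lim_{r\to\infty}\Big[\sup_{k\in\mathbb N_0}\Big(\sum_{n=r}^\infty|\widehat a_{nk}|\Big)\Big].$$ (c) If $A\in(\ell_p^{\lambda}(\widehat F):c)$, then $$\tfrac12\lim_{r\to\infty}\Big(\sup_{n\in\mathbb N_r}\|\widehat A_n-\widehat\alpha\|_q\Big)\le\|L_A\|_\chi\le\lim_{r\to\infty}\Big(\sup_{n\in\mathbb N_r}\|\widehat A_n-\widehat\alpha\|_q\Big),$$ where $\widehat\alpha=(\widehat\alpha_k)_{k\in\mathbb N_0}$ with $\widehat\alpha_k=\lim_{n\to\infty}\widehat a_{nk}$ for all $k\in\mathbb N_0$.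
   Context: $\mathbb N_0=\{0,1,2,\dots\}$; sums without limits run from $0$ to $\infty$; $\omega$ is the space of all real sequences $x=(x_k)_{k\in\mathbb N_0}$; $c_0,c$ carry the sup norm. Fibonacci numbers: $f_0=f_1=1$, $f_n=f_{n-1}+f_{n-2}$ for $n\ge 2$. $\lambda=(\lambda_k)_{k\in\mathbb N_0}$ is a fixed strictly increasing sequence of positive reals with $\lambda_k\to\infty$. Terms with negative subscript are $0$ (so $\lambda_{-1}=0$, $x_{-1}=0$). For $x\in\omega$ put $$E_n(x)=\frac1{\lambda_n}\sum_{k=0}^n(\lambda_k-\lambda_{k-1})\Big(\frac{f_k}{f_{k+1}}x_k-\frac{f_{k+1}}{f_k}x_{k-1}\Big),\qquad Ex=(E_n(x))_{n\in\mathbb N_0},$$ and $\ell_p^{\lambda}(\widehat F)=\{x\in\omega: Ex\in\ell_p\}$ with norm $\|x\|=\|Ex\|_p$, $1\le p\le\infty$. For sequence spaces $X,Y$, $A\in(X:Y)$ means that for every $x\in X$ the series $A_n(x)=\sum_ka_{nk}x_k$ converges for every $n$ and $Ax=(A_n(x))_n\in Y$; then $L_A:X\to Y$, $L_Ax=Ax$. The series defining $\widehat a_{nk}$ converge whenever $A$ belongs to one of the classes considered. The Hausdorff measure of non-compactness $\chi(Q)$ of a bounded subset $Q$ of a metric space is the infimum of all $\epsilon>0$ such that $Q$ is covered by finitely many open balls of radii less than $\epsilon$ (centres in the space). For a bounded linear operator $L:X\to Y$ between Banach spaces, $\|L\|_\chi=\chi(L(S_X))$ with $S_X=\{x\in X:\|x\|=1\}$.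 *)

theory Defs
  imports "HOL-Analysis.Analysis" "HOL-Number_Theory.Fib"
begin

section \<open>Sequence spaces\<close>

text \<open>
  The \<open>\<ell>\<^sub>p\<close> norm takes values in \<^typ>\<open>ennreal\<close>, being infinite exactly off \<open>\<ell>\<^sub>p\<close>. It is meant
  for exponents between 1 and infinity.
\<close>

definition lp_norm :: "ennreal \<Rightarrow> (nat \<Rightarrow> real) \<Rightarrow> ennreal" where
  "lp_norm p x =
    (if p = \<infinity> then (SUP k. ennreal \<bar>x k\<bar>)
     else if summable (\<lambda>k. \<bar>x k\<bar> powr enn2real p)
       then ennreal ((\<Sum>k. \<bar>x k\<bar> powr enn2real p) powr (1 / enn2real p))
     else \<infinity>)"

definition lp_space :: "ennreal \<Rightarrow> (nat \<Rightarrow> real) set" where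
  "lp_space p = {x. lp_norm p x < \<infinity>}"

definition c0_space :: "(nat \<Rightarrow> real) set" where
  "c0_space = {x. x \<longlonglongrightarrow> 0}"

definition c_space :: "(nat \<Rightarrow> real) set" where
  "c_space = {x. convergent x}"

text \<open>The metric induced by the \<open>\<ell>\<^sub>p\<close> norm; for infinite \<open>p\<close>, the sup metric used on
  \<^const>\<open>c0_space\<close> and \<^const>\<open>c_space\<close>.\<close>

definition lp_dist :: "ennreal \<Rightarrow> (nat \<Rightarrow> real) \<Rightarrow> (nat \<Rightarrow> real) \<Rightarrow> real" where
  "lp_dist p x y = enn2real (lp_norm p (\<lambda>k. x k - y k))"


section \<open>The spaces \<open>\<ell>\<^sub>p\<^sup>\<lambda>(F)\<close>\<close>

text \<open>The convention here is \<open>f\<^sub>0 = f\<^sub>1 = 1\<close>, whereas \<^const>\<open>fib\<close> starts with 0, 1.\<close>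

definition fb :: "nat \<Rightarrow> real" where
  "fb n = real (fib (Suc n))"

text \<open>\<open>prev x k\<close> is \<open>x\<^sub>k\<^sub>-\<^sub>1\<close>, where terms with negative subscript are zero.\<close>

definition prev :: "(nat \<Rightarrow> real) \<Rightarrow> nat \<Rightarrow> real" where
  "prev x k = (case k of 0 \<Rightarrow> 0 | Suc j \<Rightarrow> x j)"

definition E_op :: "(nat \<Rightarrow> real) \<Rightarrow> (nat \<Rightarrow> real) \<Rightarrow> nat \<Rightarrow> real" where
  "E_op lam x n =
    1 / lam n *
    (\<Sum>k\<le>n. (lam k - prev lam k) * (fb k / fb (k+1) * x k - fb (k+1) / fb k * prev x k))"

definition lpF_norm :: "(nat \<Rightarrow> real) \<Rightarrow> ennreal \<Rightarrow> (nat \<Rightarrow> real) \<Rightarrow> ennreal" where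
  "lpF_norm lam p x = lp_norm p (E_op lam x)"

definition lpF_space :: "(nat \<Rightarrow> real) \<Rightarrow> ennreal \<Rightarrow> (nat \<Rightarrow> real) set" where
  "lpF_space lam p = {x. E_op lam x \<in> lp_space p}"


section \<open>Matrix transformations\<close>

definition matrix_op :: "(nat \<Rightarrow> nat \<Rightarrow> real) \<Rightarrow> (nat \<Rightarrow> real) \<Rightarrow> nat \<Rightarrow> real" where
  "matrix_op A x n = (\<Sum>k. A n k * x k)"

definition matrix_class ::
  "(nat \<Rightarrow> real) set \<Rightarrow> (nat \<Rightarrow> real) set \<Rightarrow> (nat \<Rightarrow> nat \<Rightarrow> real) set" where
  "matrix_class X Y =
    {A. \<forall>x\<in>X. (\<forall>n. summable (\<lambda>k. A n k * x k)) \<and> matrix_op A x \<in> Y}"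

text \<open>The tail sum over \<open>j \<ge> k + 1\<close> is indexed by \<open>j = i + k + 1\<close>.\<close>

definition a_hat :: "(nat \<Rightarrow> real) \<Rightarrow> (nat \<Rightarrow> nat \<Rightarrow> real) \<Rightarrow> nat \<Rightarrow> nat \<Rightarrow> real" where
  "a_hat lam A n k =
    lam k *
    ((fb (k+1))\<^sup>2 * A n k / ((lam k - prev lam k) * fb k * fb (k+1))
     + (1 / ((lam k - prev lam k) * fb k * fb (k+1))
        - 1 / ((lam (k+1) - lam k) * fb (k+1) * fb (k+2)))
       * (\<Sum>i. (fb (i+k+2))\<^sup>2 * A n (i+k+1)))"


section \<open>Hausdorff measure of non-compactness\<close>

text \<open>
  The infimum is taken in \<^typ>\<open>ennreal\<close>, so that a set without such a cover has infinite measure.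
\<close>

definition hausdorff_mnc :: "'a set \<Rightarrow> ('a \<Rightarrow> 'a \<Rightarrow> real) \<Rightarrow> 'a set \<Rightarrow> ennreal" where
  "hausdorff_mnc M d Q =
    Inf {ennreal \<epsilon> | \<epsilon>. 0 < \<epsilon> \<and>
      (\<exists>\<B>. finite \<B> \<and>
           (\<forall>B\<in>\<B>. \<exists>c\<in>M. \<exists>r<\<epsilon>. B = Metric_space.mball M d c r) \<and>
           Q \<subseteq> \<Union>\<B>)}"

text \<open>Here the domain is given by its carrier and norm, the codomain by its carrier and metric.\<close>

definition op_hausdorff_mnc ::
  "'a set \<Rightarrow> ('a \<Rightarrow> ennreal) \<Rightarrow> 'b set \<Rightarrow> ('b \<Rightarrow> 'b \<Rightarrow> real) \<Rightarrow> ('a \<Rightarrow> 'b) \<Rightarrow> ennreal" where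
  "op_hausdorff_mnc X normX Y dY L = hausdorff_mnc Y dY (L ` {x\<in>X. normX x = 1})"

end

theory Submission
  imports Defs
begin

text \<open>
  The substitution \<open>y = E x\<close> identifies \<open>\<ell>\<^sub>p\<^sup>\<lambda>(F)\<close> isometrically with \<open>\<ell>\<^sub>p\<close>, and summation by parts turns
  the partial sums of \<open>A\<^sub>n(x)\<close> into finitely supported functionals of \<open>y\<close> whose coefficients tend to
  the \<open>n\<close>-th row of the matrix with hats. By Schur's theorem (in \<open>\<ell>\<^sub>1\<close>,
  weakly convergent sequences converge in norm) it follows that \<open>A\<close> acts on \<open>y\<close> as that matrix, with
  rows in \<open>\<ell>\<^sub>q\<close>. In \<open>c\<^sub>0\<close> and \<open>\<ell>\<^sub>1\<close> the Hausdorff measure of non-compactness of a coordinatewise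
  bounded set is the limit of the suprema of the norms of tails, and in \<open>c\<close> the same holds up to a
  factor 2 after subtracting limits. By \<open>\<ell>\<^sub>p\<close>--\<open>\<ell>\<^sub>q\<close> duality these suprema over the unit sphere are,
  up to a factor 2 for \<open>\<ell>\<^sub>1\<close> when \<open>p > 1\<close>, the expressions in the theorem.
\<close>

section \<open>Norm and duality of \<open>\<ell>\<^sub>p\<close>\<close>

text \<open>The delicate exponent is p = \<infinity>: a continuous functional on bounded sequences
  is not determined by its values on unit vectors, so the limit of the partial-sum functionals could
  have a part invisible to its coefficients. Convergence for all y in the space passes to every
  product y z with |z_k| \<le> 1, and this excludes such a part. All norms and measures are extended
  nonnegative reals. A supremum of tail norms decreases in r, so its limit exists as an infimum, and
  the formulas for the measure ask only for bounded coordinates. Hoelder's inequality provides these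
  row by row, so continuity of the operator is never proved separately. The factor 2 in c arises
  because a centre within \<epsilon> of x also has its limit within \<epsilon> of lim x, and both
  errors enter x_n - lim x. In the space of absolutely summable sequences the argument gives the
  upper constant 2, which is sharper than the 4 asserted.\<close>

lemma conj_exp_cases:
  fixes p q :: ennreal
  assumes "inverse p + inverse q = 1"
  obtains (inf_one) "p = \<infinity>" "q = 1"
    | (one_inf) "p = 1" "q = \<infinity>"
    | (finite) P Q where "p = ennreal P" "q = ennreal Q" "1 < P" "1 < Q" "1 / P + 1 / Q = (1::real)"
proof (cases p)
  case (real P)
  show ?thesis
  proof (cases q)
    case q: (real Q)
    have "0 < P" "0 < Q" using assms real q by (auto simp: order_less_le)
    then have "ennreal (1 / P + 1 / Q) = ennreal 1"
      using assms real q by (simp add: inverse_ennreal inverse_eq_divide)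
    then have PQ: "1 / P + 1 / Q = 1"
      using \<open>0 < P\<close> \<open>0 < Q\<close> by (subst (asm) ennreal_inj) auto
    then have "1 / P < 1" "1 / Q < 1" using \<open>0 < P\<close> \<open>0 < Q\<close> by (smt (verit) divide_pos_pos)+
    then show ?thesis using finite real q PQ \<open>0 < P\<close> \<open>0 < Q\<close> by auto
  next
    case top
    then have "0 < P" using assms real by (auto simp: order_less_le)
    then have "ennreal (1 / P) = ennreal 1"
      using assms real top by (simp add: inverse_ennreal inverse_eq_divide)
    then have "P = 1" using \<open>0 < P\<close> by (subst (asm) ennreal_inj) auto
    then show ?thesis using one_inf real top by auto
  qed
next
  case ptop: top
  show ?thesis
  proof (cases q)
    case (real Q)
    then have "0 < Q" using assms ptop by (auto simp: order_less_le)
    then have "ennreal (1 / Q) = ennreal 1"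
      using assms real ptop by (simp add: inverse_ennreal inverse_eq_divide)
    then have "Q = 1" using \<open>0 < Q\<close> by (subst (asm) ennreal_inj) auto
    then show ?thesis using inf_one real ptop by auto
  next
    case top
    then show ?thesis using assms ptop by simp
  qed
qed

lemma conj_exp_ge_1:
  fixes p q :: ennreal
  assumes "inverse p + inverse q = 1"
  shows "1 \<le> p"
  using assms by (cases rule: conj_exp_cases) auto

text \<open>Young's inequality is summed over terms scaled so that both power sums become 1. If a
  power sum is 0, scaling is impossible, but then every product vanishes.\<close>

lemma Holder_inequality_sum:
  fixes a b :: "'a \<Rightarrow> real" and P Q :: real
  assumes "1 < P" "1 < Q" "1 / P + 1 / Q = 1"
  shows "(\<Sum>i\<in>F. \<bar>a i\<bar> * \<bar>b i\<bar>)
    \<le> (\<Sum>i\<in>F. \<bar>a i\<bar> powr P) powr (1 / P) * (\<Sum>i\<in>F. \<bar>b i\<bar> powr Q) powr (1 / Q)"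
proof (cases "finite F")
  case True
  define S where "S = (\<Sum>i\<in>F. \<bar>a i\<bar> powr P)"
  define T where "T = (\<Sum>i\<in>F. \<bar>b i\<bar> powr Q)"
  have nn: "0 \<le> S" "0 \<le> T" unfolding S_def T_def by (auto intro: sum_nonneg)
  show ?thesis
  proof (cases "S = 0 \<or> T = 0")
    case True
    then have "\<forall>i\<in>F. a i = 0 \<or> b i = 0"
      using \<open>finite F\<close> unfolding S_def T_def by (auto simp: sum_nonneg_eq_0_iff)
    then have "(\<Sum>i\<in>F. \<bar>a i\<bar> * \<bar>b i\<bar>) = 0" by (intro sum.neutral) auto
    then show ?thesis by simp
  next
    case False
    then have pos: "0 < S" "0 < T" using nn by auto
    define s t where "s = S powr (1 / P)" and "t = T powr (1 / Q)"
    have st: "0 < s" "0 < t" "s powr P = S" "t powr Q = T"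
      using pos assms by (auto simp: s_def t_def powr_powr)
    have "(\<Sum>i\<in>F. (\<bar>a i\<bar> / s) * (\<bar>b i\<bar> / t))
      \<le> (\<Sum>i\<in>F. (\<bar>a i\<bar> / s) powr P / P + (\<bar>b i\<bar> / t) powr Q / Q)"
      using assms st by (intro sum_mono Youngs_inequality) auto
    also have "\<dots> = (\<Sum>i\<in>F. \<bar>a i\<bar> powr P) / S / P + (\<Sum>i\<in>F. \<bar>b i\<bar> powr Q) / T / Q"
      using st by (simp add: powr_divide sum.distrib sum_divide_distrib)
    also have "\<dots> = 1" using pos assms by (simp add: S_def [symmetric] T_def [symmetric])
    finally have "(\<Sum>i\<in>F. \<bar>a i\<bar> * \<bar>b i\<bar>) / (s * t) \<le> 1"
      by (simp add: sum_divide_distrib)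
    then show ?thesis
      using st unfolding s_def [unfolded S_def] t_def [unfolded T_def] by (simp add: divide_le_eq)
  qed
qed simp

section \<open>Partial sums, Hoelder's inequality and extremal vectors\<close>

lemma lp_norm_infinity_le_iff:
  assumes "0 \<le> c"
  shows "lp_norm \<infinity> x \<le> ennreal c \<longleftrightarrow> (\<forall>k. \<bar>x k\<bar> \<le> c)"
  using assms by (simp add: lp_norm_def SUP_le_iff)

text \<open>Unbounded partial sums violate every real bound, which is exactly the case of infinite
  norm. Estimates can thus be made on finite real sums, without deciding summability
  beforehand.\<close>

lemma lp_norm_finite_le_iff:
  assumes "1 \<le> P" "0 \<le> c"
  shows "lp_norm (ennreal P) x \<le> ennreal c \<longleftrightarrow> (\<forall>K. (\<Sum>k<K. \<bar>x k\<bar> powr P) powr (1 / P) \<le> c)"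
proof -
  have le: "s powr (1 / P) \<le> c \<longleftrightarrow> s \<le> c powr P" if "0 \<le> s" for s :: real
  proof
    assume "s powr (1 / P) \<le> c"
    then have "(s powr (1 / P)) powr P \<le> c powr P" using assms by (intro powr_mono2) auto
    then show "s \<le> c powr P" using that assms by (simp add: powr_powr)
  next
    assume "s \<le> c powr P"
    then have "s powr (1 / P) \<le> (c powr P) powr (1 / P)" using assms that by (intro powr_mono2) auto
    then show "s powr (1 / P) \<le> c" using assms by (simp add: powr_powr)
  qed
  have P: "enn2real (ennreal P) = P" "ennreal P \<noteq> \<infinity>" using assms by auto
  have nn: "0 \<le> (\<Sum>k<K. \<bar>x k\<bar> powr P)" for K by (intro sum_nonneg) auto
  show ?thesis
  proof (cases "summable (\<lambda>k. \<bar>x k\<bar> powr P)")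
    case True
    have "(\<Sum>k. \<bar>x k\<bar> powr P) \<le> c powr P \<longleftrightarrow> (\<forall>K. (\<Sum>k<K. \<bar>x k\<bar> powr P) \<le> c powr P)"
      using True by (meson order_trans suminf_le_const sum_le_suminf finite_lessThan powr_ge_zero)
    moreover have "0 \<le> (\<Sum>k. \<bar>x k\<bar> powr P)" using True by (intro suminf_nonneg) auto
    ultimately show ?thesis using True P assms by (simp add: lp_norm_def le nn)
  next
    case False
    then have "\<not> (\<forall>K. (\<Sum>k<K. \<bar>x k\<bar> powr P) \<le> c powr P)"
      by (meson bounded_imp_summable powr_ge_zero summableI_nonneg_bounded)
    then show ?thesis using False P assms by (auto simp: lp_norm_def le nn top_unique)
  qed
qed

lemma lp_norm_1_eq: "lp_norm 1 x = (\<Sum>k. ennreal \<bar>x k\<bar>)"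
proof (cases "summable (\<lambda>k. \<bar>x k\<bar>)")
  case True
  then have "0 \<le> (\<Sum>k. \<bar>x k\<bar>)" by (intro suminf_nonneg) auto
  then show ?thesis using True by (simp add: lp_norm_def suminf_ennreal2)
next
  case False
  then show ?thesis
    by (simp add: lp_norm_def) (metis abs_ge_zero infinity_ennreal_def summable_suminf_not_top)
qed

lemma lp_norm_coord_le:
  assumes "1 \<le> p"
  shows "ennreal \<bar>x k\<bar> \<le> lp_norm p x"
proof (cases "p = \<infinity>")
  case True
  then show ?thesis by (auto simp: lp_norm_def intro: SUP_upper)
next
  case False
  then obtain P where P: "p = ennreal P" "1 \<le> P"
    using assms by (metis ennreal_cases ennreal_ge_1 infinity_ennreal_def)
  show ?thesis
  proof (rule ccontr)
    \<comment> \<open>Denying the inequality places the norm below a real number, so it is itself a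
      real \<open>c\<close>, as the criterion on partial sums requires.\<close>
    assume "\<not> ?thesis"
    then have less: "lp_norm p x < ennreal \<bar>x k\<bar>" by simp
    then obtain c where c: "lp_norm p x = ennreal c" "0 \<le> c"
      by (metis ennreal_cases not_less_iff_gr_or_eq order_less_trans ennreal_less_top)
    have "(\<Sum>j<Suc k. \<bar>x j\<bar> powr P) powr (1 / P) \<le> c"
      using lp_norm_finite_le_iff[of P c x] P c by (metis order_refl)
    moreover have "\<bar>x k\<bar> powr P \<le> (\<Sum>j<Suc k. \<bar>x j\<bar> powr P)"
      by (simp add: sum_nonneg)
    then have "(\<bar>x k\<bar> powr P) powr (1 / P) \<le> (\<Sum>j<Suc k. \<bar>x j\<bar> powr P) powr (1 / P)"
      using P by (intro powr_mono2) auto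
    then have "\<bar>x k\<bar> \<le> (\<Sum>j<Suc k. \<bar>x j\<bar> powr P) powr (1 / P)"
      using P by (simp add: powr_powr)
    ultimately show False using less c by (simp add: ennreal_less_iff)
  qed
qed

text \<open>Only truncated sums occur, so summability of the products is a consequence and not a
  premise; an infinite \<open>lp_norm q a\<close> leaves nothing to show.\<close>

lemma Holder_lp_norm:
  assumes pq: "inverse p + inverse q = 1" and y: "lp_norm p y \<le> 1"
  shows "ennreal (\<Sum>k<K. \<bar>a k * y k\<bar>) \<le> lp_norm q a"
proof (cases "lp_norm q a")
  case (real c)
  from pq show ?thesis
  proof (cases rule: conj_exp_cases)
    case inf_one
    have "\<bar>y k\<bar> \<le> 1" for k
      using y inf_one lp_norm_infinity_le_iff[of 1 y] by simp
    then have "ennreal (\<Sum>k<K. \<bar>a k * y k\<bar>) \<le> ennreal (\<Sum>k<K. \<bar>a k\<bar>)"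
      by (intro ennreal_leI sum_mono) (simp add: abs_mult mult_left_le)
    also have "\<dots> \<le> (\<Sum>k. ennreal \<bar>a k\<bar>)"
      by (subst sum_ennreal[symmetric]) (auto intro: sum_le_suminf simp del: sum_ennreal)
    finally show ?thesis using inf_one by (simp add: lp_norm_1_eq)
  next
    case one_inf
    have ak: "\<bar>a k\<bar> \<le> c" for k
      using real one_inf lp_norm_infinity_le_iff[of c a] by simp
    have "ennreal (\<Sum>k<K. \<bar>a k * y k\<bar>) \<le> ennreal (c * (\<Sum>k<K. \<bar>y k\<bar>))"
      unfolding sum_distrib_left
      by (intro ennreal_leI sum_mono) (simp add: abs_mult ak mult_right_mono)
    also have "\<dots> = ennreal c * ennreal (\<Sum>k<K. \<bar>y k\<bar>)"
      using real by (intro ennreal_mult) (auto intro: sum_nonneg)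
    also have "\<dots> \<le> ennreal c * (\<Sum>k. ennreal \<bar>y k\<bar>)"
      by (subst sum_ennreal[symmetric]) (auto intro!: sum_le_suminf mult_left_mono simp del: sum_ennreal)
    also have "\<dots> \<le> ennreal c * 1" using y one_inf by (intro mult_left_mono) (auto simp: lp_norm_1_eq)
    finally show ?thesis using real by simp
  next
    case (finite P Q)
    have "(\<Sum>k<K. \<bar>a k * y k\<bar>)
      \<le> (\<Sum>i<K. \<bar>a i\<bar> powr Q) powr (1 / Q) * (\<Sum>i<K. \<bar>y i\<bar> powr P) powr (1 / P)"
      unfolding abs_mult using finite by (intro Holder_inequality_sum) auto
    also have "\<dots> \<le> c * 1"
      using lp_norm_finite_le_iff[of P 1 y] lp_norm_finite_le_iff[of Q c a] finite real y
      by (intro mult_mono) auto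
    finally show ?thesis using real by (simp add: ennreal_leI)
  qed
qed simp

text \<open>These are the equality cases of Hoelder's inequality on a long initial segment: signs
  for p = \<infinity>, one signed unit vector for p = 1, normalised powers in between. Approaching
  from below by \<open>c\<close> instead of attaining the norm also covers infinite norms. The sign
  condition on all products permits superposing several such vectors without cancellation.\<close>

lemma lp_norm_extremal:
  assumes pq: "inverse p + inverse q = 1" and c: "c < lp_norm q a"
  obtains K y where "\<And>k. K \<le> k \<Longrightarrow> y k = 0" "lp_norm p y = 1" "\<And>k. 0 \<le> a k * y k"
    "c < ennreal (\<Sum>k<K. a k * y k)"
proof -
  obtain c' where c': "c = ennreal c'" "0 \<le> c'" using c by (cases c) auto
  from pq show ?thesis
  proof (cases rule: conj_exp_cases)
    case inf_one
    obtain K where K: "c' < (\<Sum>k<K. \<bar>a k\<bar>)"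
    proof -
      have "\<not> (\<forall>K. (\<Sum>k<K. \<bar>a k\<bar> powr 1) powr (1 / 1) \<le> c')"
        using lp_norm_finite_le_iff[of 1 c' a, THEN iffD2] c c' inf_one
        by (metis ennreal_1 not_le order_refl)
      then show ?thesis using that by (auto simp: not_le sum_nonneg)
    qed
    define y where "y k = (if k < K then sgn (a k) else 0)" for k
    \<comment> \<open>A nonzero entry makes the norm of the sign vector exactly 1; without one the
      vector would vanish and miss the sphere.\<close>
    obtain k0 where "k0 < K" "a k0 \<noteq> 0"
      using K c' by (metis (no_types, lifting) abs_zero lessThan_iff not_less sum.neutral)
    then have "\<bar>y k0\<bar> = 1" by (simp add: y_def abs_sgn_eq)
    moreover have "lp_norm p y \<le> ennreal 1"
      using inf_one by (subst inf_one, subst lp_norm_infinity_le_iff) (auto simp: y_def abs_sgn_eq)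
    ultimately have "lp_norm p y = 1"
      using lp_norm_coord_le[of p y k0] conj_exp_ge_1[OF pq] by simp
    moreover have "(\<Sum>k<K. a k * y k) = (\<Sum>k<K. \<bar>a k\<bar>)"
      by (intro sum.cong) (auto simp: y_def abs_sgn)
    ultimately show ?thesis using K c'
      by (intro that[of K y]) (auto simp: y_def ennreal_less_iff linordered_idom_class.abs_sgn[symmetric])
  next
    case one_inf
    have "\<not> (\<forall>k. \<bar>a k\<bar> \<le> c')"
      using lp_norm_infinity_le_iff[of c' a, THEN iffD2] c c' one_inf by (metis not_le)
    then obtain k0 where k0: "c' < \<bar>a k0\<bar>" by (auto simp: not_le)
    define y where "y k = (if k = k0 then sgn (a k) else 0)" for k
    have "a k0 \<noteq> 0" using k0 c' by auto
    have "(\<Sum>k. ennreal \<bar>y k\<bar>) = (\<Sum>k\<in>{k0}. ennreal \<bar>y k\<bar>)"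
      by (intro suminf_finite) (auto simp: y_def)
    then have "lp_norm p y = 1"
      using \<open>a k0 \<noteq> 0\<close> one_inf by (simp add: lp_norm_1_eq y_def abs_sgn_eq)
    moreover have "(\<Sum>k<Suc k0. a k * y k) = \<bar>a k0\<bar>"
      by (subst sum.remove[of _ k0]) (auto simp: y_def abs_sgn intro!: sum.neutral)
    ultimately show ?thesis using k0 c'
      by (intro that[of "Suc k0" y]) (auto simp: y_def ennreal_less_iff linordered_idom_class.abs_sgn[symmetric])
  next
    case (finite P Q)
    have "\<not> (\<forall>K. (\<Sum>k<K. \<bar>a k\<bar> powr Q) powr (1 / Q) \<le> c')"
      using lp_norm_finite_le_iff[of Q c' a, THEN iffD2] c c' finite by (metis not_le order_less_imp_le)
    then obtain K where K: "c' < (\<Sum>k<K. \<bar>a k\<bar> powr Q) powr (1 / Q)" by (auto simp: not_le)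
    define S where "S = (\<Sum>k<K. \<bar>a k\<bar> powr Q)"
    have "S \<noteq> 0" using K c' by (auto simp: S_def)
    then have S: "0 < S" unfolding S_def by (metis sum_nonneg powr_ge_zero order_less_le)
    \<comment> \<open>Since (Q - 1) P = Q, the powers |a_k|^(Q-1) have P-th power sum S on the
      segment, so S^(1/P) normalises them.\<close>
    define y where "y k = (if k < K then sgn (a k) * \<bar>a k\<bar> powr (Q - 1) / S powr (1 / P) else 0)" for k
    have QP: "(Q - 1) * P = Q" using finite by (simp add: field_simps)
    have yP: "\<bar>y k\<bar> powr P = \<bar>a k\<bar> powr Q / S" if "k < K" for k
      using that S finite QP by (cases "a k = 0") (simp_all add: y_def abs_mult abs_sgn_eq powr_divide powr_powr)
    have ys: "(\<lambda>k. \<bar>y k\<bar> powr P) sums (\<Sum>k<K. \<bar>y k\<bar> powr P)"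
      using finite by (intro sums_finite) (auto simp: y_def)
    have "(\<Sum>k<K. \<bar>y k\<bar> powr P) = 1"
      using S by (simp add: yP sum_divide_distrib[symmetric] S_def[symmetric])
    with ys have "summable (\<lambda>k. \<bar>y k\<bar> powr P)" "(\<Sum>k. \<bar>y k\<bar> powr P) = 1"
      by (auto simp: sums_iff)
    then have y1: "lp_norm p y = 1" using finite by (simp add: lp_norm_def)
    have ay: "a k * y k = \<bar>a k\<bar> powr Q / S powr (1 / P)" if "k < K" for k
      using that finite
      by (cases "a k = 0") (auto simp: y_def abs_sgn[symmetric] powr_diff mult.assoc[symmetric])
    have "(\<Sum>k<K. a k * y k) = S / S powr (1 / P)"
      by (simp add: ay sum_divide_distrib[symmetric] S_def[symmetric])
    also have "\<dots> = S powr (1 - 1 / P)" using S by (simp add: powr_diff)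
    also have "1 - 1 / P = 1 / Q" using finite by linarith
    finally have "(\<Sum>k<K. a k * y k) = S powr (1 / Q)" .
    moreover have "0 \<le> a k * y k" for k
      using ay[of k] by (cases "k < K") (auto simp: y_def)
    ultimately show ?thesis using K c' y1
      by (intro that[of K y]) (auto simp: y_def ennreal_less_iff S_def)
  qed
qed

lemma conj_exp_exists:
  fixes p :: ennreal
  assumes "1 \<le> p"
  obtains q where "inverse p + inverse q = 1"
proof (cases p)
  case (real P)
  show ?thesis
  proof (cases "P = 1")
    case True
    then show ?thesis using real by (intro that[of top]) auto
  next
    case False
    then have "1 < P" using assms real by simp
    then have "inverse p + inverse (ennreal (P / (P - 1))) = ennreal (inverse P + inverse (P / (P - 1)))"
      using real by (simp add: inverse_ennreal)
    also have "inverse P + inverse (P / (P - 1)) = 1" using \<open>1 < P\<close> by (simp add: field_simps)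
    finally show ?thesis by (intro that) simp
  qed
next
  case top
  then show ?thesis by (intro that[of 1]) auto
qed

text \<open>The converse of Hoelder's inequality: norms are tested by finite sums against the dual
  unit sphere. Monotonicity, the triangle inequality and scaling then follow for all exponents at
  once, with no separate Minkowski argument.\<close>

lemma lp_norm_le_dual:
  assumes pq: "inverse p + inverse q = 1"
    and le: "\<And>K v. lp_norm q v = 1 \<Longrightarrow> ennreal \<bar>\<Sum>k<K. x k * v k\<bar> \<le> c"
  shows "lp_norm p x \<le> c"
proof (rule ccontr)
  assume "\<not> lp_norm p x \<le> c"
  then have "c < lp_norm p x" by simp
  then obtain K v where v: "lp_norm q v = 1" "c < ennreal (\<Sum>k<K. x k * v k)"
    using lp_norm_extremal[of q p c x] pq by (metis add.commute)
  note v(2)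
  also have "ennreal (\<Sum>k<K. x k * v k) \<le> ennreal \<bar>\<Sum>k<K. x k * v k\<bar>" by (intro ennreal_leI) simp
  also have "\<dots> \<le> c" using le v by simp
  finally show False by simp
qed

lemma Holder_suminf:
  assumes pq: "inverse p + inverse q = 1" and y: "lp_norm p y \<le> 1"
  shows "(\<Sum>k. ennreal \<bar>a k * y k\<bar>) \<le> lp_norm q a"
proof -
  have "(\<Sum>k. ennreal \<bar>a k * y k\<bar>) = (SUP K. \<Sum>k<K. ennreal \<bar>a k * y k\<bar>)"
    by (rule suminf_eq_SUP)
  then show ?thesis
    using Holder_lp_norm[OF pq y, of a] by (auto simp: SUP_le_iff)
qed

lemma lp_pairing:
  assumes pq: "inverse p + inverse q = 1" and y: "lp_norm p y \<le> 1" and a: "lp_norm q a < \<infinity>"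
  shows "summable (\<lambda>k. \<bar>a k * y k\<bar>)" "ennreal \<bar>\<Sum>k. a k * y k\<bar> \<le> lp_norm q a"
proof -
  have le: "(\<Sum>k. ennreal \<bar>a k * y k\<bar>) \<le> lp_norm q a" by (rule Holder_suminf[OF pq y])
  then show *: "summable (\<lambda>k. \<bar>a k * y k\<bar>)"
    using a by (intro summable_suminf_not_top) (auto simp: top_unique)
  have "ennreal \<bar>\<Sum>k. a k * y k\<bar> \<le> ennreal (\<Sum>k. \<bar>a k * y k\<bar>)"
    using * by (intro ennreal_leI summable_rabs)
  also have "\<dots> = (\<Sum>k. ennreal \<bar>a k * y k\<bar>)"
    using * by (intro suminf_ennreal2[symmetric]) auto
  finally show "ennreal \<bar>\<Sum>k. a k * y k\<bar> \<le> lp_norm q a" using le by simp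
qed

lemma SUP_lp_pairing:
  assumes pq: "inverse p + inverse q = 1" and a: "lp_norm q a < \<infinity>"
  shows "(SUP y\<in>{y. lp_norm p y = 1}. ennreal \<bar>\<Sum>k. a k * y k\<bar>) = lp_norm q a"
proof (rule antisym)
  show "(SUP y\<in>{y. lp_norm p y = 1}. ennreal \<bar>\<Sum>k. a k * y k\<bar>) \<le> lp_norm q a"
    using lp_pairing(2)[OF pq _ a] by (intro SUP_least) auto
  show "lp_norm q a \<le> (SUP y\<in>{y. lp_norm p y = 1}. ennreal \<bar>\<Sum>k. a k * y k\<bar>)"
  proof (rule dense_le)
    fix c assume "c < lp_norm q a"
    then obtain K y where y: "\<And>k. K \<le> k \<Longrightarrow> y k = 0" "lp_norm p y = 1"
      "c < ennreal (\<Sum>k<K. a k * y k)"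
      using lp_norm_extremal[OF pq] by metis
    have "(\<Sum>k. a k * y k) = (\<Sum>k<K. a k * y k)" using y by (intro suminf_finite) auto
    then have "c \<le> ennreal \<bar>\<Sum>k. a k * y k\<bar>"
      using y by (metis abs_ge_self ennreal_leI order_less_imp_le order_trans)
    then show "c \<le> (SUP y\<in>{y. lp_norm p y = 1}. ennreal \<bar>\<Sum>k. a k * y k\<bar>)"
      using y by (intro SUP_upper2[of y]) auto
  qed
qed

section \<open>Norm inequalities and the induced metric\<close>

lemma lp_norm_mono:
  assumes "1 \<le> p" and le: "\<And>k. \<bar>x k\<bar> \<le> \<bar>y k\<bar>"
  shows "lp_norm p x \<le> lp_norm p y"
proof -
  obtain q where pq: "inverse p + inverse q = 1" using conj_exp_exists assms by blast
  show ?thesis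
  proof (rule lp_norm_le_dual[OF pq])
    fix K v assume v: "lp_norm q v = 1"
    have "\<bar>\<Sum>k<K. x k * v k\<bar> \<le> (\<Sum>k<K. \<bar>x k * v k\<bar>)" by (rule sum_abs)
    also have "\<dots> \<le> (\<Sum>k<K. \<bar>y k * v k\<bar>)"
      by (intro sum_mono) (simp add: abs_mult le mult_right_mono)
    finally have "ennreal \<bar>\<Sum>k<K. x k * v k\<bar> \<le> ennreal (\<Sum>k<K. \<bar>y k * v k\<bar>)"
      by (rule ennreal_leI)
    also have "\<dots> \<le> lp_norm p y" using Holder_lp_norm[of q p v y K] pq v by (simp add: add.commute)
    finally show "ennreal \<bar>\<Sum>k<K. x k * v k\<bar> \<le> lp_norm p y" .
  qed
qed

lemma lp_norm_triangle:
  assumes "1 \<le> p"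
  shows "lp_norm p (\<lambda>k. x k + y k) \<le> lp_norm p x + lp_norm p y"
proof -
  obtain q where pq: "inverse p + inverse q = 1" using conj_exp_exists assms by blast
  show ?thesis
  proof (rule lp_norm_le_dual[OF pq])
    fix K v assume v: "lp_norm q v = 1"
    have "\<bar>\<Sum>k<K. (x k + y k) * v k\<bar> \<le> (\<Sum>k<K. \<bar>x k * v k\<bar> + \<bar>y k * v k\<bar>)"
      by (rule order_trans[OF sum_abs sum_mono]) (metis abs_triangle_ineq distrib_right)
    then have "ennreal \<bar>\<Sum>k<K. (x k + y k) * v k\<bar>
      \<le> ennreal ((\<Sum>k<K. \<bar>x k * v k\<bar>) + (\<Sum>k<K. \<bar>y k * v k\<bar>))"
      by (intro ennreal_leI) (simp add: sum.distrib)
    also have "\<dots> = ennreal (\<Sum>k<K. \<bar>x k * v k\<bar>) + ennreal (\<Sum>k<K. \<bar>y k * v k\<bar>)"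
      by (intro ennreal_plus) (auto intro: sum_nonneg)
    also have "\<dots> \<le> lp_norm p x + lp_norm p y"
      using Holder_lp_norm[of q p v _ K] pq v by (intro add_mono) (simp_all add: add.commute)
    finally show "ennreal \<bar>\<Sum>k<K. (x k + y k) * v k\<bar> \<le> lp_norm p x + lp_norm p y" .
  qed
qed

lemma lp_norm_scale_le:
  assumes "1 \<le> p"
  shows "lp_norm p (\<lambda>k. c * x k) \<le> ennreal \<bar>c\<bar> * lp_norm p x"
proof -
  obtain q where pq: "inverse p + inverse q = 1" using conj_exp_exists assms by blast
  show ?thesis
  proof (rule lp_norm_le_dual[OF pq])
    fix K v assume v: "lp_norm q v = 1"
    have "(\<Sum>k<K. c * x k * v k) = c * (\<Sum>k<K. x k * v k)"
      by (simp add: sum_distrib_left mult.assoc)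
    then have "ennreal \<bar>\<Sum>k<K. c * x k * v k\<bar> = ennreal \<bar>c\<bar> * ennreal \<bar>\<Sum>k<K. x k * v k\<bar>"
      by (simp add: abs_mult ennreal_mult)
    also have "\<dots> \<le> ennreal \<bar>c\<bar> * ennreal (\<Sum>k<K. \<bar>x k * v k\<bar>)"
      by (intro mult_left_mono ennreal_leI sum_abs) auto
    also have "\<dots> \<le> ennreal \<bar>c\<bar> * lp_norm p x"
      using Holder_lp_norm[of q p v _ K] pq v by (intro mult_left_mono) (simp_all add: add.commute)
    finally show "ennreal \<bar>\<Sum>k<K. c * x k * v k\<bar> \<le> ennreal \<bar>c\<bar> * lp_norm p x" .
  qed
qed

lemma lp_norm_zero [simp]: "1 \<le> p \<Longrightarrow> lp_norm p (\<lambda>k. 0) = 0"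
  using lp_norm_scale_le[of p 0 "\<lambda>k. 0"] by simp

lemma lp_norm_minus_commute: "lp_norm p (\<lambda>k. x k - y k) = lp_norm p (\<lambda>k. y k - x k)"
  unfolding lp_norm_def by (simp add: abs_minus_commute)

lemma lp_norm_diff_le:
  assumes "1 \<le> p"
  shows "lp_norm p (\<lambda>k. x k - z k) \<le> lp_norm p (\<lambda>k. x k - y k) + lp_norm p (\<lambda>k. y k - z k)"
  using lp_norm_triangle[OF assms, of "\<lambda>k. x k - y k" "\<lambda>k. y k - z k"] by simp

lemma lp_norm_sum_le:
  assumes "1 \<le> p"
  shows "lp_norm p (\<lambda>k. \<Sum>i\<in>I. c i * b i k) \<le> (\<Sum>i\<in>I. ennreal \<bar>c i\<bar> * lp_norm p (b i))"
proof (induction I rule: infinite_finite_induct)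
  case (insert i I)
  then show ?case
    using order_trans[OF lp_norm_triangle[OF assms] add_mono[OF lp_norm_scale_le[OF assms] insert.IH]]
    by simp
qed (use assms in simp_all)

lemma lp_norm_diff_finite:
  assumes "1 \<le> p" "x \<in> lp_space p" "y \<in> lp_space p"
  shows "lp_norm p (\<lambda>k. x k - y k) < \<infinity>"
proof -
  have "lp_norm p (\<lambda>k. x k - y k) \<le> lp_norm p x + lp_norm p (\<lambda>k. 0 - y k)"
    using lp_norm_diff_le[OF assms(1), of x y "\<lambda>k. 0"] by simp
  also have "lp_norm p (\<lambda>k. 0 - y k) = lp_norm p y"
    using lp_norm_minus_commute[of p "\<lambda>k. 0" y] by simp
  finally show ?thesis using assms by (auto simp: lp_space_def less_top[symmetric] top_unique)
qed

text \<open>\<open>enn2real\<close> sends infinity to 0, so \<open>lp_dist\<close> reflects the norm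
  only where the difference has finite norm; membership of both points in the space guarantees
  this.\<close>

lemma lp_dist_eq:
  assumes "1 \<le> p" "x \<in> lp_space p" "y \<in> lp_space p"
  shows "ennreal (lp_dist p x y) = lp_norm p (\<lambda>k. x k - y k)"
  using lp_norm_diff_finite[OF assms] by (simp add: lp_dist_def less_top)

lemma Metric_space_lp:
  assumes p: "1 \<le> p" and M: "M \<subseteq> lp_space p"
  shows "Metric_space M (lp_dist p)"
proof
  fix x y z
  show "0 \<le> lp_dist p x y" by (simp add: lp_dist_def)
  show "lp_dist p x y = lp_dist p y x" by (simp add: lp_dist_def lp_norm_minus_commute[of p x])
  assume "x \<in> M" "y \<in> M"
  then have xy: "x \<in> lp_space p" "y \<in> lp_space p" using M by auto
  show "lp_dist p x y = 0 \<longleftrightarrow> x = y"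
  proof
    assume "lp_dist p x y = 0"
    then have "lp_norm p (\<lambda>k. x k - y k) = 0" using lp_dist_eq[OF p xy] by simp
    then have "ennreal \<bar>x k - y k\<bar> \<le> 0" for k
      using lp_norm_coord_le[OF p, of "\<lambda>k. x k - y k" k] by simp
    then show "x = y" by (auto simp: ennreal_eq_0_iff)
  qed (use p in \<open>simp add: lp_dist_def\<close>)
  assume "z \<in> M"
  then have z: "z \<in> lp_space p" using M by auto
  have "ennreal (lp_dist p x z) \<le> ennreal (lp_dist p x y) + ennreal (lp_dist p y z)"
    using lp_norm_diff_le[OF p, of x z y] xy z p by (simp add: lp_dist_eq)
  then show "lp_dist p x z \<le> lp_dist p x y + lp_dist p y z"
    by (simp flip: ennreal_plus add: lp_dist_def)
qed

text \<open>If \<open>a\<close> had infinite norm, a geometrically weighted sum of extremal vectors would have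
  finite norm but a divergent pairing with \<open>a\<close>.\<close>

lemma lp_dual_finite:
  assumes pq: "inverse p + inverse q = 1"
    and a: "\<And>y. lp_norm p y < \<infinity> \<Longrightarrow> summable (\<lambda>k. a k * y k)"
  shows "lp_norm q a < \<infinity>"
proof (rule ccontr)
  assume "\<not> lp_norm q a < \<infinity>"
  then have top: "lp_norm q a = top" by (metis infinity_ennreal_def less_top)
  \<comment> \<open>The growth 4^i is chosen against the weights 2^(-i) used below: each summand
    still contributes at least 2^i to the pairing.\<close>
  have "\<exists>K u. lp_norm p u = 1 \<and> (\<forall>k. 0 \<le> a k * u k) \<and>
      ennreal (4 ^ i) < ennreal (\<Sum>k<K. a k * u k)" for i :: nat
  proof -
    have "ennreal (4 ^ i) < lp_norm q a" unfolding top by (rule ennreal_less_top)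
    then show ?thesis
    proof (rule lp_norm_extremal[OF pq])
      fix K u
      assume "lp_norm p u = 1" "\<And>k. 0 \<le> a k * u k" "ennreal (4 ^ i) < ennreal (\<Sum>k<K. a k * u k)"
      then show ?thesis by (intro exI[of _ K] exI[of _ u]) simp
    qed
  qed
  then obtain K :: "nat \<Rightarrow> nat" and u where u: "\<And>i. lp_norm p (u i) = 1" "\<And>i k. 0 \<le> a k * u i k"
    and big: "\<And>i. ennreal (4 ^ i) < ennreal (\<Sum>k<K i. a k * u i k)"
    by metis
  have p1: "1 \<le> p" using conj_exp_ge_1[OF pq] .
  have u1: "\<bar>u i k\<bar> \<le> 1" for i k
    using lp_norm_coord_le[OF p1, of "u i" k] u by simp
  have geo: "summable (\<lambda>i. (1/2) ^ i :: real)" by (intro summable_geometric) simp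
  define y where "y k = (\<Sum>i. (1/2) ^ i * u i k)" for k
  have sum_u: "summable (\<lambda>i. (1/2) ^ i * u i k)" for k
    by (rule summable_comparison_test'[OF geo, of 0]) (simp add: abs_mult u1 mult_left_le)
  have "lp_norm p y \<le> ennreal 2"
  proof (rule lp_norm_le_dual[OF pq])
    fix L v assume v: "lp_norm q v = 1"
    have uv: "\<bar>\<Sum>k<L. u i k * v k\<bar> \<le> 1" for i
    proof -
      have "ennreal \<bar>\<Sum>k<L. u i k * v k\<bar> \<le> ennreal (\<Sum>k<L. \<bar>u i k * v k\<bar>)"
        by (intro ennreal_leI sum_abs)
      also have "\<dots> \<le> 1"
        using Holder_lp_norm[of q p v "u i" L] pq u v by (simp add: add.commute)
      finally show ?thesis by simp
    qed
    have s1: "summable (\<lambda>i. \<bar>(1/2) ^ i * (\<Sum>k<L. u i k * v k)\<bar>)"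
      by (rule summable_comparison_test'[OF geo, of 0]) (simp add: abs_mult uv mult_left_le)
    have "(\<Sum>k<L. y k * v k) = (\<Sum>k<L. \<Sum>i. (1/2) ^ i * u i k * v k)"
      unfolding y_def using sum_u by (intro sum.cong refl suminf_mult2)
    also have "\<dots> = (\<Sum>i. \<Sum>k<L. (1/2) ^ i * u i k * v k)"
      using sum_u by (intro suminf_sum[symmetric] summable_mult2)
    also have "\<dots> = (\<Sum>i. (1/2) ^ i * (\<Sum>k<L. u i k * v k))"
      by (simp add: sum_distrib_left mult.assoc)
    finally have "\<bar>\<Sum>k<L. y k * v k\<bar> \<le> (\<Sum>i. \<bar>(1/2) ^ i * (\<Sum>k<L. u i k * v k)\<bar>)"
      using summable_rabs[OF s1] by simp
    also have "\<dots> \<le> (\<Sum>i. (1/2) ^ i)"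
      by (rule suminf_le[OF _ s1 geo]) (simp add: abs_mult uv mult_left_le)
    also have "\<dots> = 2" by (simp add: suminf_geometric)
    finally show "ennreal \<bar>\<Sum>k<L. y k * v k\<bar> \<le> ennreal 2" by (rule ennreal_leI)
  qed
  then have sum_ay: "summable (\<lambda>k. a k * y k)"
    by (intro a) (auto simp: less_top[symmetric] top_unique)
  \<comment> \<open>The sign condition makes every term of the series for a_k y_k nonnegative, so
    any single term is a lower bound.\<close>
  have ge: "(1/2) ^ i * (a k * u i k) \<le> a k * y k" for i k
  proof -
    have "a k * y k = (\<Sum>j. (1/2) ^ j * (a k * u j k))"
      unfolding y_def by (subst suminf_mult[OF sum_u, symmetric]) (simp add: mult_ac)
    moreover have "summable (\<lambda>j. (1/2) ^ j * (a k * u j k))"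
      using summable_mult[OF sum_u, of "a k" k] by (simp add: mult_ac)
    then have "(\<Sum>j\<in>{i}. (1/2) ^ j * (a k * u j k)) \<le> (\<Sum>j. (1/2) ^ j * (a k * u j k))"
      using u by (intro sum_le_suminf) auto
    ultimately show ?thesis by simp
  qed
  have "2 ^ i \<le> (\<Sum>k. a k * y k)" for i :: nat
  proof -
    have "4 ^ i \<le> (\<Sum>k<K i. a k * u i k)"
      using big[of i] by (simp add: ennreal_less_iff)
    then have "(1/2) ^ i * 4 ^ i \<le> (1/2) ^ i * (\<Sum>k<K i. a k * u i k)"
      by (intro mult_left_mono) auto
    also have "\<dots> \<le> (\<Sum>k<K i. a k * y k)"
      unfolding sum_distrib_left by (intro sum_mono ge)
    also have "\<dots> \<le> (\<Sum>k. a k * y k)"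
    proof (rule sum_le_suminf[OF sum_ay])
      fix k
      show "0 \<le> a k * y k" using ge[of 0 k] u(2)[of k 0] by simp
    qed simp
    also have "(1/2) ^ i * 4 ^ i = (2::real) ^ i"
      by (simp flip: power_mult_distrib)
    finally show ?thesis .
  qed
  then show False
    using real_arch_pow[of 2 "\<Sum>k. a k * y k"] by (simp add: not_less[symmetric])
qed

lemma lp_pairing_summable:
  assumes pq: "inverse p + inverse q = 1" and y: "lp_norm p y < \<infinity>" and a: "lp_norm q a < \<infinity>"
  shows "summable (\<lambda>k. a k * y k)"
proof -
  obtain c where c: "lp_norm p y = ennreal c" "0 \<le> c" using y by (cases "lp_norm p y") auto
  \<comment> \<open>Dividing by c + 1 brings the norm to at most 1 and avoids a division by zero
    when y = 0.\<close>
  define z where "z k = inverse (c + 1) * y k" for k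
  have "lp_norm p z \<le> ennreal \<bar>inverse (c + 1)\<bar> * ennreal c"
    unfolding z_def c(1)[symmetric] by (rule lp_norm_scale_le[OF conj_exp_ge_1[OF pq]])
  also have "\<dots> = ennreal (c / (c + 1))"
    using c by (simp add: ennreal_mult'[symmetric] divide_inverse mult.commute)
  also have "\<dots> \<le> 1" using c by simp
  finally have "summable (\<lambda>k. a k * z k)"
    by (rule summable_rabs_cancel[OF lp_pairing(1)[OF pq _ a]])
  then have "summable (\<lambda>k. (c + 1) * (a k * z k))" by (rule summable_mult)
  moreover have "(c + 1) * (a k * z k) = a k * y k" for k
    using c by (simp add: z_def)
  ultimately show ?thesis by simp
qed

text \<open>With a row of a matrix as a, this says that one coordinate is bounded on the image of
  the unit sphere, which is the boundedness demanded by the formulas for the measure of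
  non-compactness.\<close>

lemma lp_pairing_bdd:
  assumes pq: "inverse p + inverse q = 1" and a: "lp_norm q a < \<infinity>"
  shows "\<exists>K. \<forall>y. lp_norm p y = 1 \<longrightarrow> \<bar>\<Sum>k. a k * y k\<bar> \<le> K"
proof -
  obtain c where c: "lp_norm q a = ennreal c" "0 \<le> c" using a by (cases "lp_norm q a") auto
  have "\<bar>\<Sum>k. a k * y k\<bar> \<le> c" if "lp_norm p y = 1" for y
  proof -
    have "ennreal \<bar>\<Sum>k. a k * y k\<bar> \<le> ennreal c"
      using lp_pairing(2)[OF pq _ a, of y] that c by simp
    then show ?thesis using c by (subst (asm) ennreal_le_iff)
  qed
  then show ?thesis by blast
qed


section \<open>Schur's theorem and limits of functionals\<close>

text \<open>If the oscillation of the functionals did not become small on some cylinder of the unit ball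
  of \<open>\<ell>\<^sub>\<infinity>\<close>, nested cylinders would produce a point of divergence.\<close>

lemma schur_cylinder:
  fixes s :: "nat \<Rightarrow> nat \<Rightarrow> real"
  assumes abs: "\<And>m. summable (\<lambda>k. \<bar>s m k\<bar>)"
    and conv: "\<And>z. (\<And>k. \<bar>z k\<bar> \<le> 1) \<Longrightarrow> convergent (\<lambda>m. \<Sum>k. s m k * z k)"
    and e: "0 < e"
  shows "\<exists>z K M. (\<forall>k. \<bar>z k\<bar> \<le> 1) \<and>
    (\<forall>z' m l. (\<forall>k. \<bar>z' k\<bar> \<le> 1) \<longrightarrow> (\<forall>k<K. z' k = z k) \<longrightarrow> M \<le> m \<longrightarrow> M \<le> l \<longrightarrow>
      \<bar>(\<Sum>k. s m k * z' k) - (\<Sum>k. s l k * z' k)\<bar> \<le> e)"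
proof (rule ccontr)
  assume neg: "\<not> ?thesis"
  define T where "T m z = (\<Sum>k. s m k * z k)" for m z
  define Z where "Z = {z :: nat \<Rightarrow> real. \<forall>k. \<bar>z k\<bar> \<le> 1}"
  have ex: "\<exists>z'\<in>Z. (\<forall>k<K. z' k = z k) \<and> (\<exists>m\<ge>M. \<exists>l\<ge>M. e < \<bar>T m z' - T l z'\<bar>)"
    if "z \<in> Z" for z K M
  proof (rule ccontr)
    assume "\<not> ?thesis"
    then have "\<forall>z' m l. (\<forall>k. \<bar>z' k\<bar> \<le> 1) \<longrightarrow> (\<forall>k<K. z' k = z k) \<longrightarrow> M \<le> m \<longrightarrow> M \<le> l \<longrightarrow>
        \<bar>(\<Sum>k. s m k * z' k) - (\<Sum>k. s l k * z' k)\<bar> \<le> e"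
      unfolding T_def Z_def by (simp add: not_less) blast
    moreover have "\<forall>k. \<bar>z k\<bar> \<le> 1" using that by (simp add: Z_def)
    ultimately show False using neg by blast
  qed
  have sm: "summable (\<lambda>k. s m k * z k)" if "z \<in> Z" for m z
    by (rule summable_comparison_test'[OF abs[of m], of 0])
      (use that in \<open>simp add: Z_def abs_mult mult_left_le\<close>)
  \<comment> \<open>An oscillation above e at one point z' persists above e/2 on a whole cylinder
    around z', because two absolutely summable rows hardly see the far coordinates.\<close>
  have step: "\<exists>z' K' M'. z' \<in> Z \<and> (\<forall>k<K. z' k = z k) \<and> K < K' \<and> M < M' \<and>
      (\<forall>w\<in>Z. (\<forall>k<K'. w k = z' k) \<longrightarrow> (\<exists>m\<ge>M. \<exists>l\<ge>M. e / 2 < \<bar>T m w - T l w\<bar>))"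
    if z: "z \<in> Z" for z K M
  proof -
    obtain z' m l where z': "z' \<in> Z" "\<And>k. k < K \<Longrightarrow> z' k = z k" and ml: "M \<le> m" "M \<le> l"
      and gt: "e < \<bar>T m z' - T l z'\<bar>"
      using ex[OF z, of K M] by blast
    define d where "d k = \<bar>s m k\<bar> + \<bar>s l k\<bar>" for k
    have d: "summable d" "\<And>k. 0 \<le> d k"
      unfolding d_def using abs by (auto intro: summable_add)
    \<comment> \<open>Points of \<open>Z\<close> differ by at most 2 in each coordinate, so a tail
      below e/4 changes the oscillation by less than e/2.\<close>
    have "\<exists>N. \<forall>n\<ge>N. norm (\<Sum>i. d (i + n)) < e / 4"
      using suminf_exist_split[OF _ d(1), of "e/4"] e by simp
    then obtain N where N: "\<And>n. N \<le> n \<Longrightarrow> (\<Sum>i. d (i + n)) < e / 4" by fastforce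
    define K' where "K' = max N (Suc K)"
    have "e / 2 < \<bar>T m w - T l w\<bar>" if w: "w \<in> Z" "\<forall>k<K'. w k = z' k" for w
    proof -
      define h where "h k = (s m k - s l k) * (w k - z' k)" for k
      have hd: "\<bar>h k\<bar> \<le> 2 * d k" for k
      proof -
        have "\<bar>w k - z' k\<bar> \<le> 2" using w z' by (auto simp: Z_def) (smt (verit))
        moreover have "\<bar>s m k - s l k\<bar> \<le> d k" unfolding d_def by simp
        ultimately have "\<bar>s m k - s l k\<bar> * \<bar>w k - z' k\<bar> \<le> d k * 2"
          by (intro mult_mono) (auto simp: d_def)
        then show ?thesis by (simp add: h_def abs_mult)
      qed
      have sh: "summable (\<lambda>k. \<bar>h k\<bar>)"
        by (rule summable_comparison_test'[OF summable_mult[OF d(1), of 2], of 0]) (simp add: hd)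
      have eq: "(T m w - T l w) - (T m z' - T l z') = (\<Sum>k. h k)"
        unfolding T_def h_def using sm w z'
        by (simp add: suminf_diff summable_diff algebra_simps)
      have "\<bar>\<Sum>k. h k\<bar> \<le> (\<Sum>k. \<bar>h k\<bar>)" using sh by (rule summable_rabs)
      also have "\<dots> = (\<Sum>i. \<bar>h (i + K')\<bar>)"
        using suminf_split_initial_segment[OF sh, of K'] w by (simp add: h_def)
      also have "\<dots> \<le> (\<Sum>i. 2 * d (i + K'))"
        using sh d hd by (intro suminf_le summable_ignore_initial_segment[of _ K'] summable_mult) auto
      also have "\<dots> = 2 * (\<Sum>i. d (i + K'))"
        using d by (intro suminf_mult summable_ignore_initial_segment)
      also have "\<dots> < e / 2" using N[of K'] by (simp add: K'_def)
      finally have "\<bar>(T m w - T l w) - (T m z' - T l z')\<bar> < e / 2" unfolding eq .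
      then show ?thesis using gt by linarith
    qed
    then show ?thesis
      using z' ml by (intro exI[of _ z'] exI[of _ K'] exI[of _ "Suc M"]) (auto simp: K'_def)
  qed
  \<comment> \<open>The state of the dependent choice consists of a point, the number of its frozen
    coordinates and a lower bound for the row indices.\<close>
  have "\<exists>f :: nat \<Rightarrow> (nat \<Rightarrow> real) \<times> nat \<times> nat. \<forall>n. fst (f n) \<in> Z \<and>
      (\<forall>k<fst (snd (f n)). fst (f (Suc n)) k = fst (f n) k) \<and>
      fst (snd (f n)) < fst (snd (f (Suc n))) \<and> snd (snd (f n)) < snd (snd (f (Suc n))) \<and>
      (\<forall>w\<in>Z. (\<forall>k<fst (snd (f (Suc n))). w k = fst (f (Suc n)) k) \<longrightarrow>
        (\<exists>m\<ge>snd (snd (f n)). \<exists>l\<ge>snd (snd (f n)). e / 2 < \<bar>T m w - T l w\<bar>))"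
    (is "\<exists>f. \<forall>n. ?A (f n) \<and> ?B (f n) (f (Suc n)) \<and> ?C (f n) (f (Suc n)) \<and>
      ?D (f n) (f (Suc n)) \<and> ?E (f n) (f (Suc n))")
  proof -
    have "\<exists>f. \<forall>n. (?A (f n)) \<and> (?B (f n) (f (Suc n)) \<and> ?C (f n) (f (Suc n)) \<and>
        ?D (f n) (f (Suc n)) \<and> ?E (f n) (f (Suc n)))"
    proof (rule dependent_nat_choice)
      show "\<exists>x. ?A x" by (intro exI[of _ "(\<lambda>k. 0, 0, 0)"]) (auto simp: Z_def)
    next
      fix x :: "(nat \<Rightarrow> real) \<times> nat \<times> nat" and n :: nat assume "?A x"
      from step[OF this, of "fst (snd x)" "snd (snd x)"]
      show "\<exists>y. ?A y \<and> (?B x y \<and> ?C x y \<and> ?D x y \<and> ?E x y)"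
        by (simp only: split_paired_Ex fst_conv snd_conv)
    qed
    then show ?thesis by blast
  qed
  then obtain f where f: "\<And>n. ?A (f n)" "\<And>n. ?B (f n) (f (Suc n))" "\<And>n. ?C (f n) (f (Suc n))"
    "\<And>n. ?D (f n) (f (Suc n))" "\<And>n. ?E (f n) (f (Suc n))"
    by blast
  define z K M where "z n = fst (f n)" and "K n = fst (snd (f n))" and "M n = snd (snd (f n))" for n
  note f' = f[folded z_def K_def M_def]
  have Kmono: "strict_mono K" "strict_mono M" using f' by (auto simp: strict_mono_Suc_iff)
  have Kn: "n \<le> K n" "n \<le> M n" for n using Kmono strict_mono_imp_increasing by blast+
  have agree: "z j k = z n k" if "n \<le> j" "k < K n" for j n k
    using that
  proof (induction j rule: dec_induct)
    case (step j)
    then have "k < K j" using Kmono by (meson order_less_le_trans strict_mono_less_eq)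
    then show ?case using f'(2)[of j] step by simp
  qed simp
  \<comment> \<open>Coordinate k is already frozen at stage k + 1, since k < k + 1 \<le>
    \<open>K (Suc k)\<close>. Hence w lies in all the cylinders, and its values \<open>T m w\<close>
    oscillate by more than e/2 at arbitrarily late indices.\<close>
  define w where "w k = z (Suc k) k" for k
  have w: "w \<in> Z" using f' by (auto simp: w_def Z_def)
  have wz: "w k = z n k" if "k < K n" for k n
    using agree[of n "Suc k" k] agree[of "Suc k" n k] that Kn(1)[of "Suc k"]
    by (cases "n \<le> Suc k") (auto simp: w_def)
  have "Cauchy (\<lambda>m. T m w)"
    using w unfolding T_def Z_def by (intro convergent_Cauchy conv) simp
  then obtain M0 where M0: "\<And>m l. M0 \<le> m \<Longrightarrow> M0 \<le> l \<Longrightarrow> \<bar>T m w - T l w\<bar> < e / 2"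
    using CauchyD[OF _ half_gt_zero[OF e]] by (metis real_norm_def)
  obtain m l where "M M0 \<le> m" "M M0 \<le> l" "e / 2 < \<bar>T m w - T l w\<bar>"
    using f'(5)[of M0] w wz by blast
  then show False using M0[of m l] Kn(2)[of M0] by force
qed

text \<open>On the cylinder from \<open>schur_cylinder\<close> the late differences of rows are
  small as functionals. Choosing signs freely beyond K bounds the tails of their absolute sums,
  while convergence of the columns controls the first K entries. So the rows form a Cauchy sequence
  in norm, and their limit must be \<sigma>.\<close>

lemma schur_l1:
  fixes s :: "nat \<Rightarrow> nat \<Rightarrow> real"
  assumes summ: "\<And>m z. (\<And>k. \<bar>z k\<bar> \<le> 1) \<Longrightarrow> summable (\<lambda>k. s m k * z k)"
    and conv: "\<And>z. (\<And>k. \<bar>z k\<bar> \<le> 1) \<Longrightarrow> convergent (\<lambda>m. \<Sum>k. s m k * z k)"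
    and col: "\<And>k. (\<lambda>m. s m k) \<longlonglongrightarrow> \<sigma> k"
  shows "summable (\<lambda>k. \<bar>\<sigma> k\<bar>)" "(\<lambda>m. \<Sum>k. s m k) \<longlonglongrightarrow> (\<Sum>k. \<sigma> k)"
proof -
  \<comment> \<open>The sign sequence of the row is an admissible test vector.\<close>
  have abs: "summable (\<lambda>k. \<bar>s m k\<bar>)" for m
    using summ[of "\<lambda>k. sgn (s m k)" m] by (simp add: abs_sgn abs_sgn_eq)
  have cauchy: "\<exists>M. \<forall>m\<ge>M. \<forall>l\<ge>M. (\<Sum>k. \<bar>s m k - s l k\<bar>) \<le> e" if e: "0 < e" for e
  proof -
    obtain z K M where z: "\<And>k. \<bar>z k\<bar> \<le> 1"
      and M: "\<And>z' m l. \<lbrakk>\<And>k. \<bar>z' k\<bar> \<le> 1; \<And>k. k < K \<Longrightarrow> z' k = z k; M \<le> m; M \<le> l\<rbrakk>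
        \<Longrightarrow> \<bar>(\<Sum>k. s m k * z' k) - (\<Sum>k. s l k * z' k)\<bar> \<le> e / 2"
      using schur_cylinder[OF abs conv half_gt_zero[OF e]] by blast
    have "\<exists>M'. \<forall>m\<ge>M'. \<forall>l\<ge>M'. (\<Sum>k<K. \<bar>s m k - s l k\<bar>) < e / 2"
    proof -
      have "\<exists>M'. \<forall>m\<ge>M'. \<bar>(\<Sum>k<K. \<bar>s m k - \<sigma> k\<bar>)\<bar> < e / 4"
      proof -
        have "(\<lambda>m. \<Sum>k<K. \<bar>s m k - \<sigma> k\<bar>) \<longlonglongrightarrow> (\<Sum>k<K. \<bar>\<sigma> k - \<sigma> k\<bar>)"
          by (intro tendsto_intros col)
        from LIMSEQ_D[OF this, of "e/4"] \<open>0 < e\<close> show ?thesis by simp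
      qed
      then obtain M' where M': "\<And>m. M' \<le> m \<Longrightarrow> (\<Sum>k<K. \<bar>s m k - \<sigma> k\<bar>) < e / 4" by fastforce
      have "(\<Sum>k<K. \<bar>s m k - s l k\<bar>) < e / 2" if "M' \<le> m" "M' \<le> l" for m l
      proof -
        have "(\<Sum>k<K. \<bar>s m k - s l k\<bar>) \<le> (\<Sum>k<K. \<bar>s m k - \<sigma> k\<bar> + \<bar>s l k - \<sigma> k\<bar>)"
          by (intro sum_mono) simp
        also have "\<dots> = (\<Sum>k<K. \<bar>s m k - \<sigma> k\<bar>) + (\<Sum>k<K. \<bar>s l k - \<sigma> k\<bar>)"
          by (rule sum.distrib)
        finally show ?thesis using M'[OF that(1)] M'[OF that(2)] by linarith
      qed
      then show ?thesis by blast
    qed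
    then obtain M' where M': "\<And>m l. M' \<le> m \<Longrightarrow> M' \<le> l \<Longrightarrow> (\<Sum>k<K. \<bar>s m k - s l k\<bar>) < e / 2"
      by metis
    have "(\<Sum>k. \<bar>s m k - s l k\<bar>) \<le> e" if ml: "max M M' \<le> m" "max M M' \<le> l" for m l
    proof -
      define d where "d k = s m k - s l k" for k
      have sd: "summable (\<lambda>k. \<bar>d k\<bar>)"
        by (rule summable_comparison_test'[OF summable_add[OF abs[of m] abs[of l]], of 0])
          (simp add: d_def)
      \<comment> \<open>With r = 1 and r = -1 the same head, prescribed by the cylinder, meets the
        tail with both signs. The two bounds together eliminate the head, about which nothing is
        known.\<close>
      have ext: "\<bar>(\<Sum>k<K. d k * z k) + r * (\<Sum>k. \<bar>d (k + K)\<bar>)\<bar> \<le> e / 2" if "\<bar>r\<bar> = 1" for r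
      proof -
        define w where "w k = (if k < K then z k else r * sgn (d k))" for k
        have w: "\<bar>w k\<bar> \<le> 1" for k using z that by (simp add: w_def abs_mult abs_sgn_eq)
        have sdw: "summable (\<lambda>k. d k * w k)"
          using summable_diff[OF summ[of w, OF w, of m] summ[of w, OF w, of l]] by (simp add: d_def algebra_simps)
        have "(\<Sum>k. s m k * w k) - (\<Sum>k. s l k * w k) = (\<Sum>k. d k * w k)"
          using summ[of w, OF w] by (simp add: suminf_diff d_def algebra_simps)
        also have "\<dots> = (\<Sum>k. d (k + K) * w (k + K)) + (\<Sum>k<K. d k * w k)"
          by (rule suminf_split_initial_segment[OF sdw])
        also have "(\<lambda>k. d (k + K) * w (k + K)) = (\<lambda>k. r * \<bar>d (k + K)\<bar>)"
          by (auto simp: w_def abs_sgn)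
        also have "(\<Sum>k. r * \<bar>d (k + K)\<bar>) = r * (\<Sum>k. \<bar>d (k + K)\<bar>)"
          using sd by (intro suminf_mult summable_ignore_initial_segment[of "\<lambda>k. \<bar>d k\<bar>"])
        also have "(\<Sum>k<K. d k * w k) = (\<Sum>k<K. d k * z k)"
          by (intro sum.cong) (auto simp: w_def)
        finally show ?thesis
          using M[of w m l, OF w] ml by (simp add: w_def add.commute)
      qed
      have "\<bar>(\<Sum>k<K. d k * z k) + (\<Sum>k. \<bar>d (k + K)\<bar>)\<bar> \<le> e / 2"
        "\<bar>(\<Sum>k<K. d k * z k) - (\<Sum>k. \<bar>d (k + K)\<bar>)\<bar> \<le> e / 2"
        using ext[of 1] ext[of "-1"] by simp_all
      then have "(\<Sum>k. \<bar>d (k + K)\<bar>) \<le> e / 2" by linarith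
      moreover have "(\<Sum>k<K. \<bar>d k\<bar>) < e / 2" using M'[of m l] ml by (simp add: d_def)
      ultimately show ?thesis
        using suminf_split_initial_segment[OF sd, of K] by (simp add: d_def)
    qed
    then show ?thesis by blast
  qed
  \<comment> \<open>The Cauchy estimate is restricted to finitely many coordinates before l tends to
    infinity. The resulting bounds are uniform in the number of coordinates, which gives summability
    of the difference as well as its size.\<close>
  have close: "\<exists>M. \<forall>m\<ge>M. summable (\<lambda>k. \<bar>s m k - \<sigma> k\<bar>) \<and> (\<Sum>k. \<bar>s m k - \<sigma> k\<bar>) \<le> e"
    if e: "0 < e" for e
  proof -
    obtain M where M: "\<And>m l. M \<le> m \<Longrightarrow> M \<le> l \<Longrightarrow> (\<Sum>k. \<bar>s m k - s l k\<bar>) \<le> e"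
      using cauchy[OF e] by blast
    have part: "(\<Sum>k<J. \<bar>s m k - \<sigma> k\<bar>) \<le> e" if "M \<le> m" for m J
    proof (rule LIMSEQ_le_const2)
      show "(\<lambda>l. \<Sum>k<J. \<bar>s m k - s l k\<bar>) \<longlonglongrightarrow> (\<Sum>k<J. \<bar>s m k - \<sigma> k\<bar>)"
        by (intro tendsto_intros col)
      have "(\<Sum>k<J. \<bar>s m k - s l k\<bar>) \<le> e" if "M \<le> l" for l
      proof -
        have "summable (\<lambda>k. \<bar>s m k - s l k\<bar>)"
          by (rule summable_comparison_test'[OF summable_add[OF abs[of m] abs[of l]], of 0]) simp
        then have "(\<Sum>k<J. \<bar>s m k - s l k\<bar>) \<le> (\<Sum>k. \<bar>s m k - s l k\<bar>)"
          by (intro sum_le_suminf) auto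
        then show ?thesis using M[OF \<open>M \<le> m\<close> that] by simp
      qed
      then show "\<exists>N. \<forall>l\<ge>N. (\<Sum>k<J. \<bar>s m k - s l k\<bar>) \<le> e" by blast
    qed
    show ?thesis
    proof (intro exI[of _ M] allI impI conjI)
      fix m assume m: "M \<le> m"
      show "summable (\<lambda>k. \<bar>s m k - \<sigma> k\<bar>)"
        using part[OF m] by (intro summableI_nonneg_bounded) auto
      then show "(\<Sum>k. \<bar>s m k - \<sigma> k\<bar>) \<le> e"
        using part[OF m] by (intro suminf_le_const)
    qed
  qed
  obtain M where M: "summable (\<lambda>k. \<bar>s M k - \<sigma> k\<bar>)" using close[OF zero_less_one] by blast
  show s\<sigma>: "summable (\<lambda>k. \<bar>\<sigma> k\<bar>)"
    by (rule summable_comparison_test'[OF summable_add[OF abs[of M] M], of 0]) simp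
  show "(\<lambda>m. \<Sum>k. s m k) \<longlonglongrightarrow> (\<Sum>k. \<sigma> k)"
  proof (rule LIMSEQ_I)
    fix e :: real assume "0 < e"
    then obtain M where M: "\<And>m. M \<le> m \<Longrightarrow> summable (\<lambda>k. \<bar>s m k - \<sigma> k\<bar>)"
      "\<And>m. M \<le> m \<Longrightarrow> (\<Sum>k. \<bar>s m k - \<sigma> k\<bar>) \<le> e / 2"
      using close[OF half_gt_zero[OF \<open>0 < e\<close>]] by blast
    have "norm ((\<Sum>k. s m k) - (\<Sum>k. \<sigma> k)) < e" if "M \<le> m" for m
    proof -
      have "(\<Sum>k. s m k) - (\<Sum>k. \<sigma> k) = (\<Sum>k. s m k - \<sigma> k)"
        using abs[of m] s\<sigma> by (intro suminf_diff) (auto dest: summable_rabs_cancel)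
      also have "\<bar>\<dots>\<bar> \<le> (\<Sum>k. \<bar>s m k - \<sigma> k\<bar>)" using M[OF that] by (intro summable_rabs)
      finally show ?thesis using M(2)[OF that] \<open>0 < e\<close> by simp
    qed
    then show "\<exists>no. \<forall>m\<ge>no. norm ((\<Sum>k. s m k) - (\<Sum>k. \<sigma> k)) < e" by blast
  qed
qed

text \<open>Applying Schur's theorem to the rows \<open>(t\<^sub>m\<^sub>k y\<^sub>k)\<^sub>k\<close> covers all exponents at once, including
  infinity, where finitely supported sequences are not dense.\<close>

lemma lp_functional_limit:
  assumes pq: "inverse p + inverse q = 1"
    and summ: "\<And>m y. lp_norm p y < \<infinity> \<Longrightarrow> summable (\<lambda>k. t m k * y k)"
    and conv: "\<And>y. lp_norm p y < \<infinity> \<Longrightarrow> convergent (\<lambda>m. \<Sum>k. t m k * y k)"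
    and col: "\<And>k. (\<lambda>m. t m k) \<longlonglongrightarrow> \<tau> k"
  shows "lp_norm q \<tau> < \<infinity>"
    "\<And>y. lp_norm p y < \<infinity> \<Longrightarrow> (\<lambda>m. \<Sum>k. t m k * y k) \<longlonglongrightarrow> (\<Sum>k. \<tau> k * y k)"
proof -
  have p1: "1 \<le> p" using conj_exp_ge_1[OF pq] .
  have *: "summable (\<lambda>k. \<bar>\<tau> k * y k\<bar>)" "(\<lambda>m. \<Sum>k. t m k * y k) \<longlonglongrightarrow> (\<Sum>k. \<tau> k * y k)"
    if y: "lp_norm p y < \<infinity>" for y
  proof -
    \<comment> \<open>The space is solid: multipliers bounded by 1 preserve it. Test vectors z for
      Schur's theorem are thereby absorbed into y.\<close>
    have zy: "lp_norm p (\<lambda>k. y k * z k) < \<infinity>" if "\<And>k. \<bar>z k\<bar> \<le> 1" for z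
    proof -
      have "lp_norm p (\<lambda>k. y k * z k) \<le> lp_norm p y"
        using that by (intro lp_norm_mono p1) (simp add: abs_mult mult_left_le)
      then show ?thesis using y by (rule le_less_trans)
    qed
    have "(\<lambda>m. t m k * y k) \<longlonglongrightarrow> \<tau> k * y k" for k by (intro tendsto_intros col)
    note sch = schur_l1[of "\<lambda>m k. t m k * y k", OF _ _ this]
    show "summable (\<lambda>k. \<bar>\<tau> k * y k\<bar>)" "(\<lambda>m. \<Sum>k. t m k * y k) \<longlonglongrightarrow> (\<Sum>k. \<tau> k * y k)"
      using summ[OF zy] conv[OF zy] by (auto intro!: sch simp: mult.assoc)
  qed
  show "lp_norm q \<tau> < \<infinity>"
    by (rule lp_dual_finite[OF pq], rule summable_rabs_cancel, rule *(1))
  show "\<And>y. lp_norm p y < \<infinity> \<Longrightarrow> (\<lambda>m. \<Sum>k. t m k * y k) \<longlonglongrightarrow> (\<Sum>k. \<tau> k * y k)"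
    using *(2) .
qed


section \<open>Hausdorff measure of non-compactness in sequence spaces\<close>

lemma ennreal_half_le_iff:
  fixes x y :: ennreal
  shows "x / 2 \<le> y \<longleftrightarrow> x \<le> 2 * y"
proof -
  have half: "2 * z / 2 = z" for z :: ennreal
    using mult_divide_eq_ennreal[of 2 z] by (simp add: mult.commute)
  show ?thesis
  proof
    assume "x / 2 \<le> y"
    then have "2 * (x / 2) \<le> 2 * y" by (rule mult_left_mono) simp
    then show "x \<le> 2 * y" unfolding ennreal_times_divide half .
  next
    assume "x \<le> 2 * y"
    then have "x / 2 \<le> 2 * y / 2" by (rule divide_right_mono_ennreal)
    then show "x / 2 \<le> y" unfolding half .
  qed
qed

section \<open>Covers by balls and finite nets\<close>

lemma hausdorff_mnc_le:
  assumes M: "Metric_space M d" and C: "finite C" "C \<subseteq> M" and Q: "Q \<subseteq> M"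
    and cover: "\<And>x. x \<in> Q \<Longrightarrow> \<exists>c\<in>C. d c x < r" and r: "r < \<epsilon>" "0 < \<epsilon>"
  shows "hausdorff_mnc M d Q \<le> ennreal \<epsilon>"
proof -
  interpret Metric_space M d by (rule M)
  have "\<exists>\<B>. finite \<B> \<and> (\<forall>B\<in>\<B>. \<exists>c\<in>M. \<exists>r<\<epsilon>. B = mball c r) \<and> Q \<subseteq> \<Union>\<B>"
    using C Q cover r by (intro exI[of _ "(\<lambda>c. mball c r) ` C"]) (auto, fastforce)
  then show ?thesis
    unfolding hausdorff_mnc_def using r by (intro Inf_lower) blast
qed

text \<open>Lower bounds use only that every point is closer than \<epsilon> to one of finitely many
  centres in the space, so the individual radii of the balls can be forgotten.\<close>

lemma hausdorff_mnc_ge: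
  assumes M: "Metric_space M d"
    and ge: "\<And>\<epsilon> C. \<lbrakk>0 < \<epsilon>; finite C; C \<subseteq> M; \<And>x. x \<in> Q \<Longrightarrow> \<exists>c\<in>C. d c x < \<epsilon>\<rbrakk> \<Longrightarrow> l \<le> ennreal \<epsilon>"
  shows "l \<le> hausdorff_mnc M d Q"
  unfolding hausdorff_mnc_def
proof (rule Inf_greatest, clarify)
  interpret Metric_space M d by (rule M)
  fix \<epsilon> :: real and \<B>
  assume "0 < \<epsilon>" "finite \<B>" and balls: "\<forall>B\<in>\<B>. \<exists>c\<in>M. \<exists>r<\<epsilon>. B = mball c r" and "Q \<subseteq> \<Union>\<B>"
  obtain c where c: "\<And>B. B \<in> \<B> \<Longrightarrow> c B \<in> M \<and> (\<exists>r<\<epsilon>. B = mball (c B) r)"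
    using balls by metis
  show "l \<le> ennreal \<epsilon>"
  proof (rule ge[of \<epsilon> "c ` \<B>"])
    fix x assume "x \<in> Q"
    then obtain B where "B \<in> \<B>" "x \<in> B" using \<open>Q \<subseteq> \<Union>\<B>\<close> by blast
    obtain r where r: "r < \<epsilon>" "B = mball (c B) r" using c[OF \<open>B \<in> \<B>\<close>] by blast
    then have "x \<in> mball (c B) r" using \<open>x \<in> B\<close> by blast
    then have "d (c B) x < \<epsilon>" using r(1) by simp
    then show "\<exists>c\<in>c ` \<B>. d c x < \<epsilon>" using \<open>B \<in> \<B>\<close> by blast
  qed (use \<open>0 < \<epsilon>\<close> \<open>finite \<B>\<close> c in auto)
qed

text \<open>Rounding the numbers w_i(x) / \<delta> down to integers leaves finitely many patterns,
  and one representative per pattern forms the net. Allowing functions w of x in place of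
  coordinates makes room for the limit of x as an additional one. The net lies in \<open>Q\<close>
  itself, where the assumptions of later covering arguments are available.\<close>

lemma finite_quantised_net:
  fixes w :: "'a \<Rightarrow> nat \<Rightarrow> real"
  assumes bdd: "\<And>i. i < m \<Longrightarrow> \<exists>K. \<forall>x\<in>Q. \<bar>w x i\<bar> \<le> K" and \<delta>: "0 < \<delta>"
  obtains Z where "finite Z" "Z \<subseteq> Q" "\<And>x. x \<in> Q \<Longrightarrow> \<exists>z\<in>Z. \<forall>i<m. \<bar>w z i - w x i\<bar> \<le> \<delta>"
proof -
  define \<kappa> where "\<kappa> x = restrict (\<lambda>i. \<lfloor>w x i / \<delta>\<rfloor>) {..<m}" for x
  obtain K where K: "\<And>i x. i < m \<Longrightarrow> x \<in> Q \<Longrightarrow> \<bar>w x i\<bar> \<le> K i" using bdd by metis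
  have "\<kappa> ` Q \<subseteq> PiE {..<m} (\<lambda>i. {\<lfloor>- K i / \<delta>\<rfloor>..\<lfloor>K i / \<delta>\<rfloor>})"
  proof (clarsimp simp: \<kappa>_def)
    fix x i assume "x \<in> Q" "i < m"
    then have "- K i \<le> w x i" "w x i \<le> K i" using K[of i x] by auto
    then show "\<lfloor>- (K i / \<delta>)\<rfloor> \<le> \<lfloor>w x i / \<delta>\<rfloor> \<and> \<lfloor>w x i / \<delta>\<rfloor> \<le> \<lfloor>K i / \<delta>\<rfloor>"
      using \<delta> by (auto intro!: floor_mono simp: field_simps)
  qed
  then have fin: "finite (\<kappa> ` Q)"
    by (rule finite_subset) (intro finite_PiE, auto)
  define g where "g v = (SOME z. z \<in> Q \<and> \<kappa> z = v)" for v
  have g: "g (\<kappa> x) \<in> Q \<and> \<kappa> (g (\<kappa> x)) = \<kappa> x" if "x \<in> Q" for x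
    unfolding g_def by (rule someI[of _ x]) (use that in auto)
  have "\<exists>z\<in>g ` \<kappa> ` Q. \<forall>i<m. \<bar>w z i - w x i\<bar> \<le> \<delta>" if "x \<in> Q" for x
  proof (intro bexI[of _ "g (\<kappa> x)"] allI impI)
    fix i assume "i < m"
    then have "\<lfloor>w (g (\<kappa> x)) i / \<delta>\<rfloor> = \<lfloor>w x i / \<delta>\<rfloor>"
      using g[OF that] by (metis (no_types, lifting) \<kappa>_def lessThan_iff restrict_apply')
    then have "\<bar>w (g (\<kappa> x)) i / \<delta> - w x i / \<delta>\<bar> \<le> 1" by linarith
    then have "\<bar>w (g (\<kappa> x)) i - w x i\<bar> / \<delta> \<le> 1"
      using \<delta> by (simp flip: diff_divide_distrib add: abs_div)
    then show "\<bar>w (g (\<kappa> x)) i - w x i\<bar> \<le> \<delta>" using \<delta> by (simp add: divide_le_eq)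
  qed (use that in auto)
  then show ?thesis using fin g by (intro that[of "g ` \<kappa> ` Q"]) auto
qed

text \<open>All of \<open>Q\<close> lies within \<rho> of a bounded piece of a finite-dimensional
  space spanned by the \<open>b i\<close>. A finite net of that piece, fine enough, serves as
  centres for any radius above \<rho>.\<close>

lemma hausdorff_mnc_lp_le:
  fixes m :: nat
  assumes s: "1 \<le> s" and Y: "Y \<subseteq> lp_space s" and Q: "Q \<subseteq> Y"
    and b: "\<And>i. i < m \<Longrightarrow> b i \<in> lp_space s"
    and bdd: "\<And>i. i < m \<Longrightarrow> \<exists>K. \<forall>x\<in>Q. \<bar>w x i\<bar> \<le> K"
    and g: "\<And>x. x \<in> Q \<Longrightarrow> (\<lambda>n. \<Sum>i<m. w x i * b i n) \<in> Y"
    and \<rho>: "\<And>x. x \<in> Q \<Longrightarrow> lp_norm s (\<lambda>n. x n - (\<Sum>i<m. w x i * b i n)) \<le> \<rho>"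
  shows "hausdorff_mnc Y (lp_dist s) Q \<le> \<rho>"
proof (rule dense_ge)
  fix \<epsilon>' assume "\<rho> < \<epsilon>'"
  show "hausdorff_mnc Y (lp_dist s) Q \<le> \<epsilon>'"
  proof (cases \<epsilon>')
    case (real \<epsilon>)
    obtain \<rho>' where \<rho>': "\<rho> = ennreal \<rho>'" "0 \<le> \<rho>'" using \<open>\<rho> < \<epsilon>'\<close> by (cases \<rho>) auto
    then have "\<rho>' < \<epsilon>" using \<open>\<rho> < \<epsilon>'\<close> real by (simp add: ennreal_less_iff)
    define G where "G x n = (\<Sum>i<m. w x i * b i n)" for x n
    define B where "B i = enn2real (lp_norm s (b i))" for i
    have B: "lp_norm s (b i) = ennreal (B i)" "0 \<le> B i" if "i < m" for i
      using b[OF that] by (auto simp: B_def lp_space_def less_top)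
    define S where "S = (\<Sum>i<m. B i)"
    have S: "0 \<le> S" unfolding S_def using B by (intro sum_nonneg) auto
    \<comment> \<open>Quantising the coefficients costs at most \<delta> S in norm; this choice
      spends at most half of the available gap, and S + 1 stays positive when all norms are
      0.\<close>
    define \<delta> where "\<delta> = (\<epsilon> - \<rho>') / 2 / (S + 1)"
    have \<delta>: "0 < \<delta>" using \<open>\<rho>' < \<epsilon>\<close> S by (simp add: \<delta>_def)
    have "\<delta> * S \<le> \<delta> * (S + 1)" using \<delta> by (intro mult_left_mono) auto
    moreover have "\<delta> * (S + 1) = (\<epsilon> - \<rho>') / 2"
    proof -
      have "S + 1 \<noteq> 0" using S by linarith
      then show ?thesis
        unfolding nonzero_eq_divide_eq[OF \<open>S + 1 \<noteq> 0\<close>, symmetric] by (simp only: \<delta>_def)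
    qed
    ultimately have \<delta>S: "\<delta> * S \<le> (\<epsilon> - \<rho>') / 2" by linarith
    obtain Z where Z: "finite Z" "Z \<subseteq> Q" "\<And>x. x \<in> Q \<Longrightarrow> \<exists>z\<in>Z. \<forall>i<m. \<bar>w z i - w x i\<bar> \<le> \<delta>"
      using finite_quantised_net[of m Q w, OF bdd \<delta>] by blast
    have M: "Metric_space Y (lp_dist s)" using Metric_space_lp[OF s Y] .
    have "hausdorff_mnc Y (lp_dist s) Q \<le> ennreal \<epsilon>"
    \<comment> \<open>The radius is the midpoint between the proved distance bound and \<epsilon>,
      because it must exceed all distances and stay below \<epsilon>, both strictly.\<close>
    proof (rule hausdorff_mnc_le[OF M, of "G ` Z" _ "(\<rho>' + (\<epsilon> - \<rho>') / 2 + \<epsilon>) / 2"])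
      show "G ` Z \<subseteq> Y" using g Z unfolding G_def by auto
      fix x assume x: "x \<in> Q"
      obtain z where z: "z \<in> Z" "\<And>i. i < m \<Longrightarrow> \<bar>w z i - w x i\<bar> \<le> \<delta>" using Z(3)[OF x] by blast
      have in_lp: "G z \<in> lp_space s" "x \<in> lp_space s"
        using g[of z] z(1) Z(2) x Q Y unfolding G_def by blast+
      have "lp_norm s (\<lambda>n. G z n - G x n) = lp_norm s (\<lambda>n. \<Sum>i<m. (w z i - w x i) * b i n)"
        by (simp add: G_def sum_subtractf left_diff_distrib)
      also have "\<dots> \<le> (\<Sum>i<m. ennreal \<bar>w z i - w x i\<bar> * lp_norm s (b i))"
        by (rule lp_norm_sum_le[OF s])
      also have "\<dots> \<le> (\<Sum>i<m. ennreal (\<delta> * B i))"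
        using z B \<delta> by (intro sum_mono) (auto simp: ennreal_mult' intro!: mult_right_mono ennreal_leI)
      also have "\<dots> = ennreal (\<delta> * S)"
        using B \<delta> by (subst sum_ennreal) (auto simp: S_def sum_distrib_left)
      finally have "lp_norm s (\<lambda>n. G z n - G x n) \<le> ennreal (\<delta> * S)" .
      moreover have "lp_norm s (\<lambda>n. G x n - x n) \<le> ennreal \<rho>'"
        using \<rho>[OF x] \<rho>' lp_norm_minus_commute[of s x "G x"] by (simp add: G_def)
      ultimately have "lp_norm s (\<lambda>n. G z n - x n) \<le> ennreal (\<delta> * S) + ennreal \<rho>'"
        using lp_norm_diff_le[OF s, of "G z" x "G x"] by (meson add_mono order_trans)
      then have "ennreal (lp_dist s (G z) x) \<le> ennreal (\<delta> * S + \<rho>')"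
        using lp_dist_eq[OF s in_lp] \<delta> S \<rho>' by simp
      then have "lp_dist s (G z) x \<le> \<delta> * S + \<rho>'"
        using \<delta> S \<rho>' by (subst (asm) ennreal_le_iff) auto
      then have "lp_dist s (G z) x < (\<rho>' + (\<epsilon> - \<rho>') / 2 + \<epsilon>) / 2"
        using \<delta>S \<open>\<rho>' < \<epsilon>\<close> by (simp add: field_simps)
      then show "\<exists>c\<in>G ` Z. lp_dist s c x < (\<rho>' + (\<epsilon> - \<rho>') / 2 + \<epsilon>) / 2" using z by blast
    qed (use Z Q \<open>\<rho>' < \<epsilon>\<close> \<rho>' in \<open>auto simp: field_simps\<close>)
    then show ?thesis using real by simp
  qed simp
qed

section \<open>Tails and the limit formula for the measure\<close>

definition tail_seq :: "nat \<Rightarrow> (nat \<Rightarrow> real) \<Rightarrow> nat \<Rightarrow> real" where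
  "tail_seq r x n = (if n < r then 0 else x n)"

definition unit_seq :: "nat \<Rightarrow> nat \<Rightarrow> real" where
  "unit_seq i n = (if n = i then 1 else 0)"

lemma suminf_unit_seq [simp]: "(\<Sum>k. a k * unit_seq i k) = a i"
  by (subst suminf_finite[of "{i}"]) (auto simp: unit_seq_def)

lemma sum_unit_seq: "(\<Sum>i<r. x i * unit_seq i n) = (if n < r then x n else 0)"
proof -
  have "(\<Sum>i<r. x i * unit_seq i n) = (\<Sum>i<r. if n = i then x i else 0)"
    by (intro sum.cong) (auto simp: unit_seq_def)
  then show ?thesis by (simp add: sum.delta')
qed

lemma lp_norm_unit_seq:
  assumes "1 \<le> p"
  shows "lp_norm p (unit_seq i) = 1"
proof (rule antisym)
  obtain q where pq: "inverse p + inverse q = 1" using conj_exp_exists assms by blast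
  show "lp_norm p (unit_seq i) \<le> 1"
  proof (rule lp_norm_le_dual[OF pq])
    fix K v assume v: "lp_norm q v = 1"
    have "1 \<le> q" using conj_exp_ge_1[of q p] pq by (simp add: add.commute)
    then have "\<bar>v i\<bar> \<le> 1" using lp_norm_coord_le[of q v i] v by simp
    moreover have "(\<Sum>k<K. unit_seq i k * v k) = (\<Sum>k<K. if k = i then v k else 0)"
      by (intro sum.cong) (auto simp: unit_seq_def)
    ultimately show "ennreal \<bar>\<Sum>k<K. unit_seq i k * v k\<bar> \<le> 1" by simp
  qed
  show "1 \<le> lp_norm p (unit_seq i)"
    using lp_norm_coord_le[OF assms, of "unit_seq i" i] by (simp add: unit_seq_def)
qed

lemma lp_norm_tail_antimono:
  assumes "1 \<le> s" "r \<le> r'"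
  shows "lp_norm s (tail_seq r' x) \<le> lp_norm s (tail_seq r x)"
  using assms by (intro lp_norm_mono) (auto simp: tail_seq_def)

lemma decseq_SUP_tail:
  assumes "1 \<le> s"
  shows "decseq (\<lambda>r. SUP x\<in>Q. lp_norm s (tail_seq r (h x)))"
  using lp_norm_tail_antimono[OF assms] by (intro decseq_SucI SUP_mono) (meson le_Suc_eq order_refl)

lemma lp_norm_tail_le:
  assumes s: "1 \<le> s" and xc: "x \<in> lp_space s" "c \<in> lp_space s" and d: "lp_dist s c x < \<epsilon>"
  shows "lp_norm s (tail_seq r x) \<le> ennreal \<epsilon> + lp_norm s (tail_seq r c)"
proof -
  have "lp_norm s (tail_seq r x) = lp_norm s (\<lambda>n. tail_seq r x n - 0)" by simp
  also have "\<dots> \<le> lp_norm s (\<lambda>n. tail_seq r x n - tail_seq r c n) + lp_norm s (\<lambda>n. tail_seq r c n - 0)"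
    by (rule lp_norm_diff_le[OF s])
  also have "lp_norm s (\<lambda>n. tail_seq r x n - tail_seq r c n) \<le> lp_norm s (\<lambda>n. c n - x n)"
    by (intro lp_norm_mono s) (auto simp: tail_seq_def)
  also have "\<dots> \<le> ennreal \<epsilon>"
    using d lp_dist_eq[OF s xc(2,1)] by (metis ennreal_leI order_less_imp_le)
  finally show ?thesis by (simp add: add_mono)
qed

text \<open>For the upper bound, truncation at r maps \<open>Q\<close> into a bounded subset of a
  finite-dimensional space, leaving the tail as error. For the lower bound, finitely many centres
  have small tails from a common r on, so a point within \<epsilon> of a centre has a tail barely
  longer than \<epsilon>. The assumption \<open>tail\<close> expresses that truncations converge in
  norm, as in the spaces of null and of absolutely summable sequences.\<close>

lemma hausdorff_mnc_tail_limit: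
  assumes s: "1 \<le> s" and Y: "Y \<subseteq> lp_space s" and Q: "Q \<subseteq> Y"
    and fin: "\<And>x r. (\<lambda>n. if n < r then x n else 0) \<in> Y"
    and tail: "\<And>x. x \<in> Y \<Longrightarrow> (\<lambda>r. lp_norm s (tail_seq r x)) \<longlonglongrightarrow> 0"
    and bdd: "\<And>i. \<exists>K. \<forall>x\<in>Q. \<bar>x i\<bar> \<le> K"
  shows "(\<lambda>r. SUP x\<in>Q. lp_norm s (tail_seq r x)) \<longlonglongrightarrow> hausdorff_mnc Y (lp_dist s) Q"
proof -
  let ?f = "\<lambda>r. SUP x\<in>Q. lp_norm s (tail_seq r x)"
  have "(INF r. ?f r) = hausdorff_mnc Y (lp_dist s) Q"
  proof (rule antisym)
    show "hausdorff_mnc Y (lp_dist s) Q \<le> (INF r. ?f r)"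
    proof (rule INF_greatest)
      fix r
      show "hausdorff_mnc Y (lp_dist s) Q \<le> ?f r"
      proof (rule hausdorff_mnc_lp_le[OF s Y Q, of r unit_seq "\<lambda>x i. x i"])
        show "unit_seq i \<in> lp_space s" for i
          using lp_norm_unit_seq[OF s] by (simp add: lp_space_def)
        show "(\<lambda>n. \<Sum>i<r. x i * unit_seq i n) \<in> Y" for x
          using fin[of r x] by (simp add: sum_unit_seq)
        fix x assume "x \<in> Q"
        moreover have "(\<lambda>n. x n - (\<Sum>i<r. x i * unit_seq i n)) = tail_seq r x"
          by (auto simp: sum_unit_seq tail_seq_def)
        ultimately show "lp_norm s (\<lambda>n. x n - (\<Sum>i<r. x i * unit_seq i n)) \<le> ?f r"
          by (auto intro: SUP_upper)
      qed (use bdd in auto)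
    qed
    show "(INF r. ?f r) \<le> hausdorff_mnc Y (lp_dist s) Q"
    proof (rule hausdorff_mnc_ge[OF Metric_space_lp[OF s Y]])
      fix \<epsilon> :: real and C
      assume \<epsilon>: "0 < \<epsilon>" and C: "finite C" "C \<subseteq> Y" and cov: "\<And>x. x \<in> Q \<Longrightarrow> \<exists>c\<in>C. lp_dist s c x < \<epsilon>"
      show "(INF r. ?f r) \<le> ennreal \<epsilon>"
      proof (rule ennreal_le_epsilon)
        fix e :: real assume e: "0 < e"
        have "\<forall>\<^sub>F r in sequentially. lp_norm s (tail_seq r c) < ennreal e" if "c \<in> C" for c
          using order_tendstoD(2)[OF tail, of c "ennreal e"] that C e by auto
        then have "\<forall>\<^sub>F r in sequentially. \<forall>c\<in>C. lp_norm s (tail_seq r c) < ennreal e"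
          using C(1) by (simp add: eventually_ball_finite)
        then obtain r where r: "\<And>c. c \<in> C \<Longrightarrow> lp_norm s (tail_seq r c) < ennreal e"
          by (auto simp: eventually_sequentially)
        have "?f r \<le> ennreal \<epsilon> + ennreal e"
        proof (rule SUP_least)
          fix x assume x: "x \<in> Q"
          then obtain c where c: "c \<in> C" "lp_dist s c x < \<epsilon>" using cov by blast
          have "lp_norm s (tail_seq r x) \<le> ennreal \<epsilon> + lp_norm s (tail_seq r c)"
            using lp_norm_tail_le[OF s _ _ c(2)] x c C Q Y by blast
          then show "lp_norm s (tail_seq r x) \<le> ennreal \<epsilon> + ennreal e"
            using r[OF c(1)] by (meson add_left_mono order_less_imp_le order_trans)
        qed
        then show "(INF r. ?f r) \<le> ennreal \<epsilon> + ennreal e" by (rule INF_lower2[OF UNIV_I])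
      qed
    qed
  qed
  then show ?thesis using LIMSEQ_INF[OF decseq_SUP_tail[OF s, of "\<lambda>x. x" Q]] by simp
qed

section \<open>The formula for null, summable and convergent sequences\<close>

lemma c_space_subset: "c_space \<subseteq> lp_space \<infinity>"
proof
  fix x :: "nat \<Rightarrow> real" assume "x \<in> c_space"
  then have "Bseq x" by (auto simp: c_space_def dest: convergent_imp_Bseq)
  then obtain K where "0 < K" "\<forall>n. \<bar>x n\<bar> \<le> K" by (auto elim: BseqE)
  then have "lp_norm \<infinity> x \<le> ennreal K" by (subst lp_norm_infinity_le_iff) auto
  then show "x \<in> lp_space \<infinity>" by (auto simp: lp_space_def less_top[symmetric] top_unique)
qed

lemma c0_space_subset: "c0_space \<subseteq> c_space"
  by (auto simp: c0_space_def c_space_def convergent_def)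

lemma tail_tendsto_0_c0:
  assumes "x \<in> c0_space"
  shows "(\<lambda>r. lp_norm \<infinity> (tail_seq r x)) \<longlonglongrightarrow> 0"
proof (rule order_tendstoI)
  fix a :: ennreal assume "0 < a"
  then obtain e where e: "0 < e" "ennreal e < a"
    by (metis dense ennreal_cases ennreal_less_zero_iff ennreal_neq_top not_less_iff_gr_or_eq less_top top.not_eq_extremum order_less_trans)
  have "\<forall>\<^sub>F r in sequentially. \<bar>x r\<bar> < e"
    using assms e by (auto simp: c0_space_def tendsto_iff dist_real_def)
  then obtain N where N: "\<And>n. N \<le> n \<Longrightarrow> \<bar>x n\<bar> < e" by (auto simp: eventually_sequentially)
  have "lp_norm \<infinity> (tail_seq r x) \<le> ennreal e" if "N \<le> r" for r
    using N that e by (subst lp_norm_infinity_le_iff) (auto simp: tail_seq_def intro: less_imp_le)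
  then show "\<forall>\<^sub>F r in sequentially. lp_norm \<infinity> (tail_seq r x) < a"
    using e by (auto simp: eventually_sequentially intro: le_less_trans)
qed simp

lemma lp_norm_1_tail: "lp_norm 1 (tail_seq r x) = (\<Sum>n. ennreal \<bar>x (n + r)\<bar>)"
proof -
  have "(\<Sum>n. ennreal \<bar>tail_seq r x n\<bar>)
      = (\<Sum>n. ennreal \<bar>tail_seq r x (n + r)\<bar>) + (\<Sum>n<r. ennreal \<bar>tail_seq r x n\<bar>)"
    by (intro suminf_offset) auto
  then show ?thesis by (simp add: lp_norm_1_eq tail_seq_def)
qed

lemma tail_tendsto_0_l1:
  assumes "x \<in> lp_space 1"
  shows "(\<lambda>r. lp_norm 1 (tail_seq r x)) \<longlonglongrightarrow> 0"
proof -
  have sx: "summable (\<lambda>n. \<bar>x n\<bar>)"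
    using assms by (intro summable_suminf_not_top) (auto simp: lp_space_def lp_norm_1_eq)
  then have "lp_norm 1 (tail_seq r x) = ennreal (\<Sum>n. \<bar>x (n + r)\<bar>)" for r
    unfolding lp_norm_1_tail
    by (intro suminf_ennreal2 summable_ignore_initial_segment[of "\<lambda>n. \<bar>x n\<bar>"]) auto
  moreover have "(\<lambda>r. \<Sum>n. \<bar>x (n + r)\<bar>) \<longlonglongrightarrow> 0"
    by (rule suminf_exist_split2[OF sx])
  ultimately show ?thesis using tendsto_ennrealI by fastforce
qed

lemma hausdorff_mnc_c0_limit:
  assumes "Q \<subseteq> c0_space" "\<And>i. \<exists>K. \<forall>x\<in>Q. \<bar>x i\<bar> \<le> K"
  shows "(\<lambda>r. SUP x\<in>Q. lp_norm \<infinity> (tail_seq r x)) \<longlonglongrightarrow> hausdorff_mnc c0_space (lp_dist \<infinity>) Q"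
proof (rule hausdorff_mnc_tail_limit)
  show "(\<lambda>n. if n < r then x n else 0) \<in> c0_space" for x r
    unfolding c0_space_def mem_Collect_eq
    by (rule tendsto_eventually, rule eventually_sequentiallyI[of r]) simp
qed (use assms tail_tendsto_0_c0 c_space_subset c0_space_subset in auto)

lemma hausdorff_mnc_l1_limit:
  assumes "Q \<subseteq> lp_space 1" "\<And>i. \<exists>K. \<forall>x\<in>Q. \<bar>x i\<bar> \<le> K"
  shows "(\<lambda>r. SUP x\<in>Q. lp_norm 1 (tail_seq r x)) \<longlonglongrightarrow> hausdorff_mnc (lp_space 1) (lp_dist 1) Q"
proof (rule hausdorff_mnc_tail_limit)
  show "(\<lambda>n. if n < r then x n else 0) \<in> lp_space 1" for x r
  proof -
    have "(\<Sum>k. ennreal \<bar>if k < r then x k else 0\<bar>) = (\<Sum>k<r. ennreal \<bar>if k < r then x k else 0\<bar>)"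
      by (intro suminf_finite) auto
    then show ?thesis by (simp add: lp_space_def lp_norm_1_eq less_top[symmetric] del: sum_ennreal)
  qed
qed (use assms tail_tendsto_0_l1 in auto)

text \<open>Tails need not vanish in c, but those of x - lim x do. The finite-dimensional
  approximation therefore keeps the first r coordinates together with the limit, which is why
  bounded limits are assumed beside bounded coordinates.\<close>

lemma hausdorff_mnc_c_limit:
  assumes Q: "Q \<subseteq> c_space" and bdd: "\<And>i. \<exists>K. \<forall>x\<in>Q. \<bar>x i\<bar> \<le> K" and lim_bdd: "\<exists>K. \<forall>x\<in>Q. \<bar>lim x\<bar> \<le> K"
  obtains l where
    "(\<lambda>r. SUP x\<in>Q. lp_norm \<infinity> (tail_seq r (\<lambda>n. x n - lim x))) \<longlonglongrightarrow> l"
    "l \<le> 2 * hausdorff_mnc c_space (lp_dist \<infinity>) Q"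
    "hausdorff_mnc c_space (lp_dist \<infinity>) Q \<le> l"
proof -
  let ?f = "\<lambda>r. SUP x\<in>Q. lp_norm \<infinity> (tail_seq r (\<lambda>n. x n - lim x))"
  let ?h = "hausdorff_mnc c_space (lp_dist \<infinity>) Q"
  have s: "(1::ennreal) \<le> \<infinity>" by simp
  have "?h \<le> (INF r. ?f r)"
  proof (rule INF_greatest)
    fix r
    \<comment> \<open>Index r carries the constant 1 from position r on, with coefficient lim x;
      hence r + 1 vectors are used.\<close>
    define b where "b i = (if i < r then unit_seq i else tail_seq r (\<lambda>n. 1))" for i
    define w where "w x i = (if i < r then x i else lim x)" for x :: "nat \<Rightarrow> real" and i
    have wb: "(\<Sum>i<Suc r. w x i * b i n) = (if n < r then x n else lim x)" for x n
    proof -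
      have "(\<Sum>i<Suc r. w x i * b i n) = (\<Sum>i<r. x i * unit_seq i n) + lim x * tail_seq r (\<lambda>n. 1) n"
        by (simp add: w_def b_def)
      then show ?thesis by (simp add: sum_unit_seq) (simp add: tail_seq_def)
    qed
    show "?h \<le> ?f r"
    proof (rule hausdorff_mnc_lp_le[OF s c_space_subset Q, of "Suc r" b w])
      show "b i \<in> lp_space \<infinity>" for i
      proof -
        have "lp_norm \<infinity> (b i) \<le> ennreal 1"
          by (subst lp_norm_infinity_le_iff) (auto simp: b_def unit_seq_def tail_seq_def)
        then show ?thesis by (auto simp: lp_space_def less_top[symmetric] top_unique)
      qed
      show "\<exists>K. \<forall>x\<in>Q. \<bar>w x i\<bar> \<le> K" for i
        using bdd[of i] lim_bdd by (cases "i < r") (auto simp: w_def)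
      fix x assume x: "x \<in> Q"
      have "(\<lambda>n. if n < r then x n else lim x) \<longlonglongrightarrow> lim x"
        by (rule tendsto_eventually, rule eventually_sequentiallyI[of r]) simp
      then show "(\<lambda>n. \<Sum>i<Suc r. w x i * b i n) \<in> c_space"
        unfolding wb c_space_def convergent_def by blast
      have "(\<lambda>n. x n - (\<Sum>i<Suc r. w x i * b i n)) = tail_seq r (\<lambda>n. x n - lim x)"
        unfolding wb by (auto simp: tail_seq_def)
      then show "lp_norm \<infinity> (\<lambda>n. x n - (\<Sum>i<Suc r. w x i * b i n)) \<le> ?f r"
        using x by (auto intro: SUP_upper)
    qed
  qed
  moreover have "(INF r. ?f r) / 2 \<le> ?h"
  proof (rule hausdorff_mnc_ge[OF Metric_space_lp[OF s c_space_subset]])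
    fix \<epsilon> :: real and C
    assume \<epsilon>: "0 < \<epsilon>" and C: "finite C" "C \<subseteq> c_space"
      and cov: "\<And>x. x \<in> Q \<Longrightarrow> \<exists>c\<in>C. lp_dist \<infinity> c x < \<epsilon>"
    have "(INF r. ?f r) \<le> ennreal (2 * \<epsilon>)"
    proof (rule ennreal_le_epsilon)
      fix e :: real assume e: "0 < e"
      have "\<forall>\<^sub>F r in sequentially. \<forall>n\<ge>r. \<bar>c n - lim c\<bar> < e" if "c \<in> C" for c
      proof -
        have "c \<longlonglongrightarrow> lim c" using that C by (auto simp: c_space_def convergent_LIMSEQ_iff)
        then obtain N where "\<forall>n\<ge>N. \<bar>c n - lim c\<bar> < e" using e by (auto simp: LIMSEQ_iff)
        then show ?thesis by (auto intro!: eventually_sequentiallyI[of N])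
      qed
      then have "\<forall>\<^sub>F r in sequentially. \<forall>c\<in>C. \<forall>n\<ge>r. \<bar>c n - lim c\<bar> < e"
        using C(1) by (simp add: eventually_ball_finite)
      then obtain r where r: "\<And>c n. c \<in> C \<Longrightarrow> r \<le> n \<Longrightarrow> \<bar>c n - lim c\<bar> < e"
        by (auto simp: eventually_sequentially)
      have "?f r \<le> ennreal (2 * \<epsilon> + e)"
      proof (rule SUP_least)
        fix x assume x: "x \<in> Q"
        then obtain c where c: "c \<in> C" "lp_dist \<infinity> c x < \<epsilon>" using cov by blast
        have "c \<in> lp_space \<infinity>" "x \<in> lp_space \<infinity>" using c C x Q c_space_subset by auto
        then have "lp_norm \<infinity> (\<lambda>n. c n - x n) \<le> ennreal \<epsilon>"
          using lp_dist_eq[OF s] c(2) by (metis ennreal_leI order_less_imp_le)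
        then have cx: "\<bar>c n - x n\<bar> \<le> \<epsilon>" for n
          using \<epsilon> by (subst (asm) lp_norm_infinity_le_iff) auto
        have "c \<longlonglongrightarrow> lim c" "x \<longlonglongrightarrow> lim x"
          using c C x Q by (auto simp: c_space_def convergent_LIMSEQ_iff)
        then have "(\<lambda>n. \<bar>c n - x n\<bar>) \<longlonglongrightarrow> \<bar>lim c - lim x\<bar>" by (intro tendsto_intros)
        then have "\<bar>lim c - lim x\<bar> \<le> \<epsilon>" by (rule LIMSEQ_le_const2) (use cx in auto)
        then have "\<bar>x n - lim x\<bar> \<le> 2 * \<epsilon> + e" if "r \<le> n" for n
          using cx[of n] r[OF c(1) that] by linarith
        then show "lp_norm \<infinity> (tail_seq r (\<lambda>n. x n - lim x)) \<le> ennreal (2 * \<epsilon> + e)"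
          using \<epsilon> e by (subst lp_norm_infinity_le_iff) (auto simp: tail_seq_def)
      qed
      also have "\<dots> = ennreal (2 * \<epsilon>) + ennreal e" using \<epsilon> e by (intro ennreal_plus) auto
      finally show "(INF r. ?f r) \<le> ennreal (2 * \<epsilon>) + ennreal e" by (rule INF_lower2[OF UNIV_I])
    qed
    then have "(INF r. ?f r) / 2 \<le> ennreal (2 * \<epsilon>) / ennreal 2"
      by (simp add: divide_right_mono_ennreal)
    also have "\<dots> = ennreal \<epsilon>" using \<epsilon> by (subst divide_ennreal) auto
    finally show "(INF r. ?f r) / 2 \<le> ennreal \<epsilon>" .
  qed
  then have "(INF r. ?f r) \<le> 2 * ?h" by (simp only: ennreal_half_le_iff)
  moreover have "?f \<longlonglongrightarrow> (INF r. ?f r)"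
    by (intro LIMSEQ_INF decseq_SUP_tail) simp
  ultimately show ?thesis using that by blast
qed


section \<open>Matrices acting on the unit sphere of \<open>\<ell>\<^sub>p\<close>\<close>

lemma lp_norm_infinity_tail: "lp_norm \<infinity> (tail_seq r x) = (SUP n\<in>{r..}. ennreal \<bar>x n\<bar>)"
proof (rule antisym)
  show "lp_norm \<infinity> (tail_seq r x) \<le> (SUP n\<in>{r..}. ennreal \<bar>x n\<bar>)"
    by (auto simp: lp_norm_def tail_seq_def not_less intro!: SUP_least SUP_upper)
  have "ennreal \<bar>x n\<bar> \<le> lp_norm \<infinity> (tail_seq r x)" if "r \<le> n" for n
    using lp_norm_coord_le[of \<infinity> "tail_seq r x" n] that by (simp add: tail_seq_def)
  then show "(SUP n\<in>{r..}. ennreal \<bar>x n\<bar>) \<le> lp_norm \<infinity> (tail_seq r x)"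
    by (intro SUP_least) auto
qed

text \<open>The sup norm is itself a supremum over coordinates, so it can be exchanged with the
  supremum over the sphere. Each row then yields exactly its dual norm and no constant is
  lost.\<close>

lemma SUP_lp_norm_infinity_tail:
  assumes pq: "inverse p + inverse q = 1" and B: "\<And>n. lp_norm q (B n) < \<infinity>"
  shows "(SUP y\<in>{y. lp_norm p y = 1}. lp_norm \<infinity> (tail_seq r (\<lambda>n. \<Sum>k. B n k * y k)))
    = (SUP n\<in>{r..}. lp_norm q (B n))"
proof -
  have "(SUP y\<in>{y. lp_norm p y = 1}. SUP n\<in>{r..}. ennreal \<bar>\<Sum>k. B n k * y k\<bar>)
    = (SUP n\<in>{r..}. SUP y\<in>{y. lp_norm p y = 1}. ennreal \<bar>\<Sum>k. B n k * y k\<bar>)"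
    by (rule SUP_commute)
  then show ?thesis unfolding lp_norm_infinity_tail by (simp only: SUP_lp_pairing[OF pq B])
qed

lemma hausdorff_mnc_matrix_c0:
  assumes pq: "inverse p + inverse q = 1" and B: "\<And>n. lp_norm q (B n) < \<infinity>"
    and Y: "\<And>y. lp_norm p y = 1 \<Longrightarrow> (\<lambda>n. \<Sum>k. B n k * y k) \<in> c0_space"
  shows "(\<lambda>r. SUP n\<in>{r..}. lp_norm q (B n)) \<longlonglongrightarrow>
    hausdorff_mnc c0_space (lp_dist \<infinity>) ((\<lambda>y n. \<Sum>k. B n k * y k) ` {y. lp_norm p y = 1})"
proof -
  let ?Q = "(\<lambda>y n. \<Sum>k. B n k * y k) ` {y. lp_norm p y = 1}"
  have "\<exists>K. \<forall>x\<in>?Q. \<bar>x i\<bar> \<le> K" for i using lp_pairing_bdd[OF pq B[of i]] by auto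
  then have "(\<lambda>r. SUP x\<in>?Q. lp_norm \<infinity> (tail_seq r x)) \<longlonglongrightarrow> hausdorff_mnc c0_space (lp_dist \<infinity>) ?Q"
    using Y by (intro hausdorff_mnc_c0_limit) auto
  then show ?thesis by (simp add: image_image SUP_lp_norm_infinity_tail[OF pq B, simplified])
qed

text \<open>The functional sending y to the limit of its image is represented by \<alpha>, again by
  \<open>lp_functional_limit\<close>. Subtracting limits therefore replaces the rows B_n by B_n -
  \<alpha>. That argument multiplies y by bounded sequences, so the mapping property is assumed on
  the whole space and not only on the sphere.\<close>

lemma hausdorff_mnc_matrix_c:
  assumes pq: "inverse p + inverse q = 1" and B: "\<And>n. lp_norm q (B n) < \<infinity>"
    and Y: "\<And>y. lp_norm p y < \<infinity> \<Longrightarrow> (\<lambda>n. \<Sum>k. B n k * y k) \<in> c_space"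
  defines "Q \<equiv> (\<lambda>y n. \<Sum>k. B n k * y k) ` {y. lp_norm p y = 1}"
  shows "\<exists>\<alpha> l. (\<forall>k. (\<lambda>n. B n k) \<longlonglongrightarrow> \<alpha> k) \<and>
    (\<lambda>r. SUP n\<in>{r..}. lp_norm q (\<lambda>k. B n k - \<alpha> k)) \<longlonglongrightarrow> l \<and>
    l / 2 \<le> hausdorff_mnc c_space (lp_dist \<infinity>) Q \<and> hausdorff_mnc c_space (lp_dist \<infinity>) Q \<le> l"
proof -
  have p1: "1 \<le> p" and q1: "1 \<le> q"
    using conj_exp_ge_1[of p q] conj_exp_ge_1[of q p] pq by (auto simp: add.commute)
  define \<alpha> where "\<alpha> k = lim (\<lambda>n. B n k)" for k
  have \<alpha>: "(\<lambda>n. B n k) \<longlonglongrightarrow> \<alpha> k" for k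
    using Y[of "unit_seq k"] lp_norm_unit_seq[OF p1, of k]
    by (simp add: c_space_def \<alpha>_def convergent_LIMSEQ_iff)
  have conv: "convergent (\<lambda>m. \<Sum>k. B m k * y k)" if "lp_norm p y < \<infinity>" for y
    using Y[OF that] by (simp add: c_space_def)
  note lims = lp_functional_limit[OF pq lp_pairing_summable[OF pq _ B] conv \<alpha>]
  have \<alpha>q: "lp_norm q \<alpha> < \<infinity>" by (rule lims)
  have lim: "lim (\<lambda>n. \<Sum>k. B n k * y k) = (\<Sum>k. \<alpha> k * y k)" if "lp_norm p y < \<infinity>" for y
    by (rule limI, rule lims(2)[OF _ _ that])
  have D: "lp_norm q (\<lambda>k. B n k - \<alpha> k) < \<infinity>" for n
    using B \<alpha>q by (intro lp_norm_diff_finite q1) (auto simp: lp_space_def)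
  have diff: "(\<Sum>k. B n k * y k) - lim (\<lambda>n. \<Sum>k. B n k * y k) = (\<Sum>k. (B n k - \<alpha> k) * y k)"
    if "lp_norm p y < \<infinity>" for y n
    unfolding lim[OF that] left_diff_distrib
    by (intro suminf_diff lp_pairing_summable[OF pq that] B \<alpha>q)
  have fin: "lp_norm p y < \<infinity>" if "lp_norm p y = 1" for y using that by simp
  obtain l where l: "(\<lambda>r. SUP x\<in>Q. lp_norm \<infinity> (tail_seq r (\<lambda>n. x n - lim x))) \<longlonglongrightarrow> l"
    "l \<le> 2 * hausdorff_mnc c_space (lp_dist \<infinity>) Q" "hausdorff_mnc c_space (lp_dist \<infinity>) Q \<le> l"
  proof (rule hausdorff_mnc_c_limit[of Q])
    show "Q \<subseteq> c_space" using Y fin by (auto simp: Q_def)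
    show "\<exists>K. \<forall>x\<in>Q. \<bar>x i\<bar> \<le> K" for i using lp_pairing_bdd[OF pq B[of i]] by (auto simp: Q_def)
    show "\<exists>K. \<forall>x\<in>Q. \<bar>lim x\<bar> \<le> K"
      using lp_pairing_bdd[OF pq \<alpha>q] lim[OF fin] by (auto simp: Q_def)
  qed
  have "(SUP x\<in>Q. lp_norm \<infinity> (tail_seq r (\<lambda>n. x n - lim x)))
      = (SUP n\<in>{r..}. lp_norm q (\<lambda>k. B n k - \<alpha> k))" for r
  proof -
    have "(SUP x\<in>Q. lp_norm \<infinity> (tail_seq r (\<lambda>n. x n - lim x)))
      = (SUP y\<in>{y. lp_norm p y = 1}. lp_norm \<infinity> (tail_seq r (\<lambda>n. \<Sum>k. (B n k - \<alpha> k) * y k)))"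
      unfolding Q_def image_image by (intro SUP_cong refl) (simp add: diff[OF fin])
    then show ?thesis by (simp only: SUP_lp_norm_infinity_tail[OF pq D])
  qed
  then show ?thesis using \<alpha> l by (auto simp: ennreal_half_le_iff)
qed

section \<open>Matrices into absolutely summable sequences\<close>

lemma suminf_ennreal_swap:
  fixes f :: "nat \<Rightarrow> nat \<Rightarrow> ennreal"
  shows "(\<Sum>i. \<Sum>j. f i j) = (\<Sum>j. \<Sum>i. f i j)"
proof -
  have "(\<integral>\<^sup>+ j. (\<Sum>i. f i j) \<partial>count_space UNIV) = (\<Sum>i. \<integral>\<^sup>+ j. f i j \<partial>count_space UNIV)"
    by (rule nn_integral_suminf) simp
  then show ?thesis by (simp add: nn_integral_count_space_nat)
qed

text \<open>Exchanging the two summations bounds every value by the largest column sum, and unit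
  vectors realise each column sum. Hence equality holds for p = 1, without the constants of the
  other exponents.\<close>

lemma SUP_lp_norm_1_tail_one:
  assumes B: "\<And>n. lp_norm \<infinity> (B n) < \<infinity>"
  shows "(SUP y\<in>{y. lp_norm 1 y = 1}. lp_norm 1 (tail_seq r (\<lambda>n. \<Sum>k. B n k * y k)))
    = (SUP k. \<Sum>n. ennreal \<bar>B (n + r) k\<bar>)"
proof (rule antisym)
  let ?s = "SUP k. \<Sum>n. ennreal \<bar>B (n + r) k\<bar>"
  show "(SUP y\<in>{y. lp_norm 1 y = 1}. lp_norm 1 (tail_seq r (\<lambda>n. \<Sum>k. B n k * y k))) \<le> ?s"
  proof (rule SUP_least)
    fix y assume "y \<in> {y. lp_norm 1 y = 1}"
    then have y: "lp_norm 1 y = 1" by simp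
    have pq: "inverse 1 + inverse \<infinity> = (1::ennreal)" by simp
    have "ennreal \<bar>\<Sum>k. B n k * y k\<bar> \<le> (\<Sum>k. ennreal \<bar>B n k * y k\<bar>)" for n
    proof -
      have s: "summable (\<lambda>k. \<bar>B n k * y k\<bar>)" using y by (intro lp_pairing(1)[OF pq _ B]) simp
      then have "(\<Sum>k. ennreal \<bar>B n k * y k\<bar>) = ennreal (\<Sum>k. \<bar>B n k * y k\<bar>)"
        by (intro suminf_ennreal2) auto
      then show ?thesis using ennreal_leI[OF summable_rabs[OF s]] by (simp only:)
    qed
    then have "lp_norm 1 (tail_seq r (\<lambda>n. \<Sum>k. B n k * y k))
      \<le> (\<Sum>n. \<Sum>k. ennreal \<bar>B (n + r) k * y k\<bar>)"
      unfolding lp_norm_1_tail by (intro suminf_le summableI)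
    also have "\<dots> = (\<Sum>k. \<Sum>n. ennreal \<bar>B (n + r) k\<bar> * ennreal \<bar>y k\<bar>)"
      by (subst suminf_ennreal_swap) (simp add: abs_mult ennreal_mult)
    also have "\<dots> = (\<Sum>k. (\<Sum>n. ennreal \<bar>B (n + r) k\<bar>) * ennreal \<bar>y k\<bar>)"
      by (simp only: ennreal_suminf_multc)
    also have "\<dots> \<le> (\<Sum>k. ?s * ennreal \<bar>y k\<bar>)"
      by (intro suminf_le summableI mult_right_mono SUP_upper) auto
    also have "\<dots> = ?s * lp_norm 1 y" by (simp only: ennreal_suminf_cmult lp_norm_1_eq)
    also have "\<dots> = ?s" unfolding y by (rule mult_1_right)
    finally show "lp_norm 1 (tail_seq r (\<lambda>n. \<Sum>k. B n k * y k)) \<le> ?s" .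
  qed
  show "?s \<le> (SUP y\<in>{y. lp_norm 1 y = 1}. lp_norm 1 (tail_seq r (\<lambda>n. \<Sum>k. B n k * y k)))"
  proof (rule SUP_least)
    fix k
    have "(\<Sum>n. ennreal \<bar>B (n + r) k\<bar>) = lp_norm 1 (tail_seq r (\<lambda>n. \<Sum>j. B n j * unit_seq k j))"
      by (simp only: lp_norm_1_tail suminf_unit_seq)
    also have "\<dots> \<le> (SUP y\<in>{y. lp_norm 1 y = 1}. lp_norm 1 (tail_seq r (\<lambda>n. \<Sum>k. B n k * y k)))"
      by (rule SUP_upper) (simp add: lp_norm_unit_seq)
    finally show "(\<Sum>n. ennreal \<bar>B (n + r) k\<bar>)
      \<le> (SUP y\<in>{y. lp_norm 1 y = 1}. lp_norm 1 (tail_seq r (\<lambda>n. \<Sum>k. B n k * y k)))" .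
  qed
qed

lemma hausdorff_mnc_matrix_l1_one:
  assumes B: "\<And>n. lp_norm \<infinity> (B n) < \<infinity>"
    and Y: "\<And>y. lp_norm 1 y = 1 \<Longrightarrow> (\<lambda>n. \<Sum>k. B n k * y k) \<in> lp_space 1"
  shows "(\<lambda>r. SUP k. \<Sum>n. ennreal \<bar>B (n + r) k\<bar>) \<longlonglongrightarrow>
    hausdorff_mnc (lp_space 1) (lp_dist 1) ((\<lambda>y n. \<Sum>k. B n k * y k) ` {y. lp_norm 1 y = 1})"
proof -
  let ?Q = "(\<lambda>y n. \<Sum>k. B n k * y k) ` {y. lp_norm 1 y = 1}"
  have "\<exists>K. \<forall>x\<in>?Q. \<bar>x i\<bar> \<le> K" for i using lp_pairing_bdd[of 1 \<infinity>, OF _ B[of i]] by auto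
  then have "(\<lambda>r. SUP x\<in>?Q. lp_norm 1 (tail_seq r x)) \<longlonglongrightarrow> hausdorff_mnc (lp_space 1) (lp_dist 1) ?Q"
    using Y by (intro hausdorff_mnc_l1_limit) auto
  then show ?thesis by (simp only: image_image SUP_lp_norm_1_tail_one[OF B])
qed

lemma finite_sums_le_lp_norm_1_tail:
  assumes "finite N" "N \<subseteq> {r..}"
  shows "ennreal \<bar>\<Sum>n\<in>N. x n\<bar> \<le> lp_norm 1 (tail_seq r x)"
proof -
  have "ennreal \<bar>\<Sum>n\<in>N. x n\<bar> \<le> ennreal (\<Sum>n\<in>N. \<bar>tail_seq r x n\<bar>)"
    using assms(2) by (intro ennreal_leI order_trans[OF sum_abs] sum_mono) (auto simp: tail_seq_def)
  also have "\<dots> = (\<Sum>n\<in>N. ennreal \<bar>tail_seq r x n\<bar>)" by (simp add: sum_ennreal)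
  also have "\<dots> \<le> (\<Sum>n. ennreal \<bar>tail_seq r x n\<bar>)"
    using assms(1) by (intro sum_le_suminf) auto
  finally show ?thesis by (simp add: lp_norm_1_eq)
qed

text \<open>Splitting into nonnegative and negative terms costs the factor 2.\<close>

lemma lp_norm_1_tail_le_finite_sums:
  "lp_norm 1 (tail_seq r x) \<le> 2 * (SUP N\<in>{N. finite N \<and> N \<subseteq> {r..}}. ennreal \<bar>\<Sum>n\<in>N. x n\<bar>)"
    (is "_ \<le> 2 * ?s")
proof -
  have "(\<Sum>n<K. ennreal \<bar>tail_seq r x n\<bar>) \<le> 2 * ?s" for K
  proof -
    let ?P = "{n\<in>{r..<K}. 0 \<le> x n}" and ?M = "{n\<in>{r..<K}. x n < 0}"
    have "(\<Sum>n<K. \<bar>tail_seq r x n\<bar>) = (\<Sum>n\<in>{r..<K}. \<bar>x n\<bar>)"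
      by (rule sum.mono_neutral_cong_right) (auto simp: tail_seq_def)
    also have "{r..<K} = ?P \<union> ?M" by auto
    also have "(\<Sum>n\<in>?P \<union> ?M. \<bar>x n\<bar>) = (\<Sum>n\<in>?P. \<bar>x n\<bar>) + (\<Sum>n\<in>?M. \<bar>x n\<bar>)"
      by (intro sum.union_disjoint) auto
    also have "(\<Sum>n\<in>?P. \<bar>x n\<bar>) = (\<Sum>n\<in>?P. x n)" by (intro sum.cong) auto
    also have "(\<Sum>n\<in>?M. \<bar>x n\<bar>) = - (\<Sum>n\<in>?M. x n)"
      unfolding sum_negf[symmetric] by (intro sum.cong) auto
    also have "(\<Sum>n\<in>?P. x n) + - (\<Sum>n\<in>?M. x n) \<le> \<bar>\<Sum>n\<in>?P. x n\<bar> + \<bar>\<Sum>n\<in>?M. x n\<bar>" by linarith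
    finally have "ennreal (\<Sum>n<K. \<bar>tail_seq r x n\<bar>)
      \<le> ennreal (\<bar>\<Sum>n\<in>?P. x n\<bar> + \<bar>\<Sum>n\<in>?M. x n\<bar>)" by (rule ennreal_leI)
    also have "\<dots> = ennreal \<bar>\<Sum>n\<in>?P. x n\<bar> + ennreal \<bar>\<Sum>n\<in>?M. x n\<bar>" by (intro ennreal_plus) auto
    also have "\<dots> \<le> ?s + ?s" by (intro add_mono SUP_upper) auto
    finally show ?thesis by (simp add: sum_ennreal mult_2)
  qed
  then show ?thesis unfolding lp_norm_1_eq suminf_eq_SUP by (intro SUP_least)
qed

lemma hausdorff_mnc_matrix_l1:
  assumes pq: "inverse p + inverse q = 1" and B: "\<And>n. lp_norm q (B n) < \<infinity>"
    and Y: "\<And>y. lp_norm p y = 1 \<Longrightarrow> (\<lambda>n. \<Sum>k. B n k * y k) \<in> lp_space 1"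
  defines "Q \<equiv> (\<lambda>y n. \<Sum>k. B n k * y k) ` {y. lp_norm p y = 1}"
  shows "\<exists>l. (\<lambda>r. SUP N\<in>{N. finite N \<and> N \<subseteq> {r..}}. lp_norm q (\<lambda>k. \<Sum>n\<in>N. B n k)) \<longlonglongrightarrow> l \<and>
    l \<le> hausdorff_mnc (lp_space 1) (lp_dist 1) Q \<and>
    hausdorff_mnc (lp_space 1) (lp_dist 1) Q \<le> 2 * l"
proof -
  let ?h = "hausdorff_mnc (lp_space 1) (lp_dist 1) Q"
  define F where "F r = {N. finite N \<and> N \<subseteq> {r::nat..}}" for r
  define \<phi> where "\<phi> r = (SUP N\<in>F r. lp_norm q (\<lambda>k. \<Sum>n\<in>N. B n k))" for r
  define \<tau> where "\<tau> r = (SUP x\<in>Q. lp_norm 1 (tail_seq r x))" for r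
  have q1: "1 \<le> q" using conj_exp_ge_1[of q p] pq by (simp add: add.commute)
  have fin: "lp_norm q (\<lambda>k. \<Sum>n\<in>N. B n k) < \<infinity>" if "finite N" for N
  proof -
    have "lp_norm q (\<lambda>k. \<Sum>n\<in>N. 1 * B n k) \<le> (\<Sum>n\<in>N. ennreal \<bar>1\<bar> * lp_norm q (B n))"
      by (rule lp_norm_sum_le[OF q1])
    also have "\<dots> < \<infinity>" using B that by (simp add: less_top)
    finally show ?thesis by simp
  qed
  \<comment> \<open>Duality turns the norm of a finite row sum into a supremum over the sphere.
    After exchanging suprema, each y leaves only finite sums of coordinates of its image, to be
    compared with the norm of the tail.\<close>
  have \<phi>: "\<phi> r = (SUP y\<in>{y. lp_norm p y = 1}. SUP N\<in>F r. ennreal \<bar>\<Sum>n\<in>N. \<Sum>k. B n k * y k\<bar>)" for r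
  proof -
    have eq: "(\<Sum>k. (\<Sum>n\<in>N. B n k) * y k) = (\<Sum>n\<in>N. \<Sum>k. B n k * y k)" if "lp_norm p y = 1" for y N
      unfolding sum_distrib_right using that
      by (intro suminf_sum lp_pairing_summable[OF pq _ B]) simp
    have "\<phi> r = (SUP N\<in>F r. SUP y\<in>{y. lp_norm p y = 1}. ennreal \<bar>\<Sum>k. (\<Sum>n\<in>N. B n k) * y k\<bar>)"
      unfolding \<phi>_def by (intro SUP_cong refl SUP_lp_pairing[OF pq fin, symmetric]) (simp add: F_def)
    also have "\<dots> = (SUP y\<in>{y. lp_norm p y = 1}. SUP N\<in>F r. ennreal \<bar>\<Sum>n\<in>N. \<Sum>k. B n k * y k\<bar>)"
      by (subst SUP_commute) (intro SUP_cong refl, simp add: eq)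
    finally show ?thesis .
  qed
  have \<phi>\<tau>: "\<phi> r \<le> \<tau> r" for r
    unfolding \<phi> \<tau>_def Q_def image_image
  proof (rule SUP_mono)
    fix y assume y: "y \<in> {y. lp_norm p y = 1}"
    show "\<exists>z\<in>{y. lp_norm p y = 1}. (SUP N\<in>F r. ennreal \<bar>\<Sum>n\<in>N. \<Sum>k. B n k * y k\<bar>)
        \<le> lp_norm 1 (tail_seq r (\<lambda>n. \<Sum>k. B n k * z k))"
      by (rule bexI[OF _ y], rule SUP_least, rule finite_sums_le_lp_norm_1_tail)
        (simp_all add: F_def)
  qed
  have \<tau>\<phi>: "\<tau> r \<le> 2 * \<phi> r" for r
    unfolding \<phi> \<tau>_def Q_def image_image
  proof (rule SUP_least)
    fix y assume y: "y \<in> {y. lp_norm p y = 1}"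
    have "lp_norm 1 (tail_seq r (\<lambda>n. \<Sum>k. B n k * y k))
      \<le> 2 * (SUP N\<in>F r. ennreal \<bar>\<Sum>n\<in>N. \<Sum>k. B n k * y k\<bar>)"
      unfolding F_def by (rule lp_norm_1_tail_le_finite_sums)
    also have "\<dots> \<le> 2 * (SUP y\<in>{y. lp_norm p y = 1}. SUP N\<in>F r. ennreal \<bar>\<Sum>n\<in>N. \<Sum>k. B n k * y k\<bar>)"
      by (rule mult_left_mono[OF SUP_upper[OF y]]) simp
    finally show "lp_norm 1 (tail_seq r (\<lambda>n. \<Sum>k. B n k * y k))
      \<le> 2 * (SUP y\<in>{y. lp_norm p y = 1}. SUP N\<in>F r. ennreal \<bar>\<Sum>n\<in>N. \<Sum>k. B n k * y k\<bar>)" .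
  qed
  have "\<exists>K. \<forall>x\<in>Q. \<bar>x i\<bar> \<le> K" for i using lp_pairing_bdd[OF pq B[of i]] by (auto simp: Q_def)
  then have \<tau>_lim: "\<tau> \<longlonglongrightarrow> ?h"
    unfolding \<tau>_def using Y by (intro hausdorff_mnc_l1_limit) (auto simp: Q_def)
  have "decseq \<phi>" unfolding \<phi>_def by (intro decseq_SucI SUP_subset_mono) (auto simp: F_def)
  then have \<phi>_lim: "\<phi> \<longlonglongrightarrow> (INF r. \<phi> r)" by (rule LIMSEQ_INF)
  have "(INF r. \<phi> r) \<le> ?h"
    by (rule LIMSEQ_le[OF \<phi>_lim \<tau>_lim]) (use \<phi>\<tau> in auto)
  moreover have "(\<lambda>r. 2 * \<phi> r) \<longlonglongrightarrow> 2 * (INF r. \<phi> r)"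
    using \<phi>_lim by (intro ennreal_tendsto_cmult) auto
  then have "?h \<le> 2 * (INF r. \<phi> r)"
    by (rule LIMSEQ_le[OF \<tau>_lim]) (use \<tau>\<phi> in auto)
  ultimately show ?thesis using \<phi>_lim unfolding \<phi>_def F_def by blast
qed


section \<open>Inverting \<open>E\<close>\<close>

lemma fb_rec: "fb (Suc (Suc n)) = fb (Suc n) + fb n"
  by (simp add: fb_def)

lemma fb_pos: "0 < fb n"
  by (simp add: fb_def fib_neq_0_nat)

lemma fb_Suc_ge_2: "1 \<le> n \<Longrightarrow> 2 \<le> fb (Suc n)"
proof (induction n rule: dec_induct)
  case (step n)
  then show ?case using fb_rec[of n] fb_pos[of n] by simp
qed (simp add: fb_def)

lemma prev_0 [simp]: "prev x 0 = 0" and prev_Suc [simp]: "prev x (Suc n) = x n"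
  by (simp_all add: prev_def)

locale lambda_sequence =
  fixes lam :: "nat \<Rightarrow> real"
  assumes mono: "strict_mono lam"
    and pos: "\<And>k. 0 < lam k"
    and unbounded: "filterlim lam at_top sequentially"
begin

abbreviation lam_diff :: "nat \<Rightarrow> real" where
  "lam_diff k \<equiv> lam k - prev lam k"

lemma lam_diff_pos: "0 < lam_diff k"
  using mono pos by (cases k) (auto simp: strict_mono_Suc_iff)

definition bracket :: "nat \<Rightarrow> real" where
  "bracket k = 1 / (lam_diff k * fb k * fb (k+1)) - 1 / ((lam (k+1) - lam k) * fb (k+1) * fb (k+2))"

text \<open>Writing x_n = f_{n+1}^2 s_n turns the Fibonacci difference in E into f_n f_{n+1} (s_n -
  s_{n-1}). So s_n is the sum over k \<le> n of (\<lambda>_k y_k - \<lambda>_{k-1} y_{k-1}) /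
  ((\<lambda>_k - \<lambda>_{k-1}) f_k f_{k+1}). Collecting the terms in y_k gives the bracket below
  the diagonal and a single fraction on it.\<close>

definition E_inv_coeff :: "nat \<Rightarrow> nat \<Rightarrow> real" where
  "E_inv_coeff n k = (fb (n+1))\<^sup>2 *
    (if k < n then lam k * bracket k
     else if k = n then lam k / (lam_diff k * fb k * fb (k+1)) else 0)"

definition E_inv :: "(nat \<Rightarrow> real) \<Rightarrow> nat \<Rightarrow> real" where
  "E_inv y n = (\<Sum>k\<le>n. E_inv_coeff n k * y k)"

lemma E_inv_difference:
  "lam_diff n * (fb n / fb (n+1) * E_inv y n - fb (n+1) / fb n * prev (E_inv y) n)
    = lam n * y n - prev (\<lambda>k. lam k * y k) n"
proof -
  define c where "c k = lam k / (lam_diff k * fb k * fb (k+1))" for k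
  define s where "s n = (\<Sum>k<n. lam k * bracket k * y k) + c n * y n" for n
  have E: "E_inv y n = (fb (n+1))\<^sup>2 * s n" for n
    unfolding E_inv_def lessThan_Suc_atMost[symmetric] s_def
    by (simp add: E_inv_coeff_def c_def distrib_left sum_distrib_left mult.assoc)
  have nz: "fb k \<noteq> 0" "lam_diff k \<noteq> 0" for k
    using fb_pos[of k] lam_diff_pos[of k] by auto
  show ?thesis
  proof (cases n)
    case 0
    then show ?thesis using nz[of 0] nz(1)[of 1]
      by (simp add: E s_def c_def power2_eq_square)
  next
    case (Suc m)
    have "s (Suc m) - s m = c (Suc m) * y (Suc m) + (lam m * bracket m - c m) * y m"
      by (simp add: s_def algebra_simps)
    moreover have "lam m * bracket m - c m = - (lam m / (lam_diff n * fb n * fb (n+1)))"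
      using Suc by (simp add: bracket_def c_def algebra_simps)
    ultimately have "s n - s m = (lam n * y n - lam m * y m) / (lam_diff n * fb n * fb (n+1))"
      using Suc by (simp add: c_def diff_divide_distrib)
    then have "lam_diff n * (fb n * fb (n+1) * (s n - s m)) = lam n * y n - lam m * y m"
      using nz by simp
    moreover have "fb n / fb (n+1) * E_inv y n - fb (n+1) / fb n * prev (E_inv y) n
        = fb n * fb (n+1) * (s n - s m)"
      using Suc nz(1)[of n] nz(1)[of "n+1"] by (simp add: E power2_eq_square algebra_simps)
    ultimately show ?thesis using Suc by simp
  qed
qed

lemma sum_diff_prev: "(\<Sum>k\<le>n. g k - prev g k) = g n" for g :: "nat \<Rightarrow> real"
  by (induction n) auto

lemma E_op_E_inv: "E_op lam (E_inv y) = y"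
proof
  fix n
  show "E_op lam (E_inv y) n = y n"
    unfolding E_op_def E_inv_difference sum_diff_prev using pos[of n] by simp
qed

text \<open>Differences of consecutive weighted means isolate one term, which determines x_n from
  x_{n-1} because its leading coefficient is nonzero. Injectivity makes the right inverse
  \<open>E_inv\<close> two-sided without a second computation.\<close>

lemma E_op_inject:
  assumes eq: "E_op lam x = E_op lam x'"
  shows "x = x'"
proof
  fix n
  define h where "h x k = lam_diff k * (fb k / fb (k+1) * x k - fb (k+1) / fb k * prev x k)" for x k
  have sums: "(\<Sum>k\<le>n. h x k) = (\<Sum>k\<le>n. h x' k)" for n
    using fun_cong[OF eq, of n] pos[of n] by (simp add: E_op_def h_def)
  have h: "h x n = h x' n" for n
    using sums[of n] sums[of "n - 1"] by (cases n) auto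
  have nz: "fb k \<noteq> 0" "lam_diff k \<noteq> 0" for k
    using fb_pos[of k] lam_diff_pos[of k] by auto
  show "x n = x' n"
  proof (induction n)
    case 0
    then show ?case using h[of 0] nz(1)[of 0] nz(1)[of 1] nz(2)[of 0] by (simp add: h_def)
  next
    case (Suc n)
    then show ?case using h[of "Suc n"] nz(1)[of "Suc n"] nz(1)[of "Suc (Suc n)"] nz(2)[of "Suc n"]
      by (simp add: h_def)
  qed
qed

lemma E_inv_E_op: "E_inv (E_op lam x) = x"
  by (rule E_op_inject) (rule E_op_E_inv)

lemma E_inv_in_lpF: "E_inv y \<in> lpF_space lam p \<longleftrightarrow> lp_norm p y < \<infinity>"
  by (simp add: lpF_space_def E_op_E_inv lp_space_def)

lemma E_inv_unit_seq: "E_inv (unit_seq k) = (\<lambda>n. E_inv_coeff n k)"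
proof
  fix n
  have "E_inv (unit_seq k) n = (\<Sum>j\<le>n. if j = k then E_inv_coeff n j else 0)"
    unfolding E_inv_def by (intro sum.cong) (auto simp: unit_seq_def)
  also have "\<dots> = E_inv_coeff n k" by (simp add: E_inv_coeff_def)
  finally show "E_inv (unit_seq k) n = E_inv_coeff n k" .
qed

text \<open>If every bracket vanished, then \<open>\<lambda>\<^sub>k - \<lambda>\<^sub>k\<^sub>-\<^sub>1 = \<lambda>\<^sub>0 / (f\<^sub>k f\<^sub>k\<^sub>+\<^sub>1)\<close>, which is summable.\<close>

lemma bracket_nonzero: "\<exists>k. bracket k \<noteq> 0"
proof (rule ccontr)
  assume "\<not> ?thesis"
  then have zero: "bracket k = 0" for k by blast
  \<comment> \<open>Vanishing brackets make these products independent of k, and the conventions f_0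
    = f_1 = 1 and \<lambda>_{-1} = 0 determine the value.\<close>
  have d: "lam_diff k * fb k * fb (k+1) = lam 0" for k
  proof (induction k)
    case (Suc k)
    have "1 / (lam_diff k * fb k * fb (k+1)) = 1 / (lam_diff (Suc k) * fb (Suc k) * fb (Suc k + 1))"
      using zero[of k] by (simp add: bracket_def)
    then show ?case using Suc by (metis div_by_1 divide_divide_eq_right mult_1)
  qed (simp add: fb_def)
  \<comment> \<open>A telescoping majorant: u_{k+1} - u_{k+2} = 1/f_{k+1} - 1/f_{k+3} = f_{k+2} /
    (f_{k+1} f_{k+3}), which is at least 1/(f_{k+1} f_{k+2}) because f_{k+3} \<le> 2 f_{k+2} \<le>
    f_{k+2}^2.\<close>
  define u where "u k = 1 / fb k + 1 / fb (k+1)" for k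
  have step: "lam (Suc k) - lam k \<le> lam 0 * (u (Suc k) - u (Suc (Suc k)))" for k
  proof -
    let ?a = "fb (Suc k)" and ?b = "fb (Suc (Suc k))"
    have ab: "0 < ?a" "2 \<le> ?b" "fb (Suc (Suc (Suc k))) = ?b + ?a" "?a \<le> ?b"
      using fb_pos[of "Suc k"] fb_Suc_ge_2[of "Suc k"] fb_rec[of "Suc k"] fb_rec[of k] fb_pos[of k]
      by auto
    have "?b + ?a \<le> 2 * ?b" using ab by simp
    also have "\<dots> \<le> ?b * ?b" using ab by (intro mult_right_mono) auto
    finally have "1 / (?a * ?b) \<le> ?b / (?a * (?b + ?a))"
      using ab by (simp add: divide_simps mult_ac)
    also have "\<dots> = u (Suc k) - u (Suc (Suc k))"
      using ab by (simp add: u_def divide_simps) (simp add: algebra_simps)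
    finally have "lam 0 * (1 / (?a * ?b)) \<le> lam 0 * (u (Suc k) - u (Suc (Suc k)))"
      using pos[of 0] by (intro mult_left_mono) auto
    moreover have "lam (Suc k) - lam k = lam 0 * (1 / (?a * ?b))"
      using d[of "Suc k"] ab by (simp add: field_simps)
    ultimately show ?thesis by simp
  qed
  have bound: "lam n + lam 0 * u (Suc n) \<le> lam 0 + lam 0 * u 1" for n
  proof (induction n)
    case (Suc n)
    then show ?case using step[of n] by (simp add: right_diff_distrib)
  qed simp
  have "0 \<le> lam 0 * u (Suc n)" for n
    using pos[of 0] fb_pos[of "Suc n"] fb_pos[of "Suc n + 1"] by (simp add: u_def)
  then have "lam n \<le> lam 0 + lam 0 * u 1" for n using bound[of n] by (smt (verit))
  moreover obtain n where "lam 0 + lam 0 * u 1 < lam n"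
    using unbounded by (metis eventually_happens filterlim_at_top_dense sequentially_bot)
  ultimately show False by (meson not_less)
qed

section \<open>From the matrix A to the matrix with hats\<close>

lemma suminf_row_E_inv_coeff:
  assumes summ: "\<And>k. summable (\<lambda>j. a j * E_inv_coeff j k)"
  shows "(\<Sum>j. a j * E_inv_coeff j k) =
    lam k * ((fb (k+1))\<^sup>2 * a k / (lam_diff k * fb k * fb (k+1))
      + bracket k * (\<Sum>i. (fb (i+k+2))\<^sup>2 * a (i+k+1)))"
proof -
  have tail: "a (i + Suc k) * E_inv_coeff (i + Suc k) k = lam k * bracket k * ((fb (i+k+2))\<^sup>2 * a (i+k+1))"
    for i k by (simp add: E_inv_coeff_def)
  \<comment> \<open>Below the diagonal every column of the inverse is a multiple of f_{j+1}^2. One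
    column with nonzero factor therefore yields convergence of the series of f_{j+1}^2 a_j, and with
    it all the tails in the formula.\<close>
  obtain k0 where k0: "bracket k0 \<noteq> 0" using bracket_nonzero by blast
  have "summable (\<lambda>i. a (i + Suc k0) * E_inv_coeff (i + Suc k0) k0)"
    using summ by (rule summable_ignore_initial_segment)
  then have "summable (\<lambda>i. (fb (i + Suc k0 + 1))\<^sup>2 * a (i + Suc k0))"
    unfolding tail using k0 pos[of k0] by (subst (asm) summable_cmult_iff) auto
  then have "summable (\<lambda>j. (fb (j + 1))\<^sup>2 * a j)"
    by (rule summable_iff_shift[of "\<lambda>j. (fb (j + 1))\<^sup>2 * a j" "Suc k0", THEN iffD1])
  then have sm: "summable (\<lambda>i. (fb (i+k+2))\<^sup>2 * a (i+k+1))"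
    using summable_ignore_initial_segment[of "\<lambda>j. (fb (j + 1))\<^sup>2 * a j" "Suc k"] by simp
  have "(\<Sum>j. a j * E_inv_coeff j k)
      = (\<Sum>i. a (i + Suc k) * E_inv_coeff (i + Suc k) k) + (\<Sum>j<Suc k. a j * E_inv_coeff j k)"
    by (rule suminf_split_initial_segment[OF summ])
  also have "(\<Sum>i. a (i + Suc k) * E_inv_coeff (i + Suc k) k)
      = lam k * bracket k * (\<Sum>i. (fb (i+k+2))\<^sup>2 * a (i+k+1))"
    unfolding tail by (rule suminf_mult[OF sm])
  also have "(\<Sum>j<Suc k. a j * E_inv_coeff j k) = a k * E_inv_coeff k k"
    by (simp add: E_inv_coeff_def)
  finally show ?thesis by (simp add: E_inv_coeff_def algebra_simps)
qed

text \<open>Formally this is associativity, A (E^{-1} y) = (A E^{-1}) y. Only convergence of the row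
  series of A is given, so the summations cannot be exchanged directly; the truncated rows
  \<open>t m\<close> make each stage finite and leave a limit of functionals.\<close>

lemma matrix_op_E_inv:
  assumes pq: "inverse p + inverse q = 1"
    and summ: "\<And>x. x \<in> lpF_space lam p \<Longrightarrow> summable (\<lambda>k. A n k * x k)"
  shows "lp_norm q (a_hat lam A n) < \<infinity>"
    and "lp_norm p y < \<infinity> \<Longrightarrow> matrix_op A (E_inv y) n = (\<Sum>k. a_hat lam A n k * y k)"
proof -
  define t where "t m k = (\<Sum>j<m. A n j * E_inv_coeff j k)" for m k
  have t0: "t m k = 0" if "m \<le> k" for m k
    unfolding t_def using that by (intro sum.neutral) (auto simp: E_inv_coeff_def)
  have partial: "(\<Sum>k. t m k * y k) = (\<Sum>j<m. A n j * E_inv y j)" for m y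
  proof -
    have E: "E_inv y j = (\<Sum>k<m. E_inv_coeff j k * y k)" if "j < m" for j
      unfolding E_inv_def using that
      by (intro sum.mono_neutral_left) (auto simp: E_inv_coeff_def)
    have "(\<Sum>k. t m k * y k) = (\<Sum>k<m. t m k * y k)"
      by (rule suminf_finite) (auto simp: t0)
    also have "\<dots> = (\<Sum>j<m. \<Sum>k<m. A n j * (E_inv_coeff j k * y k))"
      unfolding t_def sum_distrib_right by (subst sum.swap) (simp add: mult.assoc)
    also have "\<dots> = (\<Sum>j<m. A n j * E_inv y j)"
      by (intro sum.cong refl) (simp add: E sum_distrib_left)
    finally show ?thesis .
  qed
  have summE: "summable (\<lambda>j. A n j * E_inv y j)" if "lp_norm p y < \<infinity>" for y
    using summ that E_inv_in_lpF by blast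
  have lim: "(\<lambda>m. \<Sum>k. t m k * y k) \<longlonglongrightarrow> matrix_op A (E_inv y) n" if "lp_norm p y < \<infinity>" for y
    unfolding partial matrix_op_def using summE[OF that] by (rule summable_LIMSEQ)
  have coeff: "summable (\<lambda>j. A n j * E_inv_coeff j k)" for k
    using summE[of "unit_seq k"] lp_norm_unit_seq[OF conj_exp_ge_1[OF pq], of k]
    by (simp add: E_inv_unit_seq)
  have "(\<Sum>j. A n j * E_inv_coeff j k) = a_hat lam A n k" for k
    unfolding suminf_row_E_inv_coeff[OF coeff] by (simp add: a_hat_def bracket_def)
  then have col: "(\<lambda>m. t m k) \<longlonglongrightarrow> a_hat lam A n k" for k
    unfolding t_def using summable_LIMSEQ[OF coeff, of k] by simp
  have summ_t: "summable (\<lambda>k. t m k * y k)" for m y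
    by (rule summable_finite[of "{..<m}"]) (auto simp: t0)
  have conv_t: "convergent (\<lambda>m. \<Sum>k. t m k * y k)" if "lp_norm p y < \<infinity>" for y
    using lim[OF that] by (rule convergentI)
  note * = lp_functional_limit[OF pq summ_t conv_t col]
  show "lp_norm q (a_hat lam A n) < \<infinity>" by (rule *(1))
  show "matrix_op A (E_inv y) n = (\<Sum>k. a_hat lam A n k * y k)" if "lp_norm p y < \<infinity>"
    by (rule LIMSEQ_unique[OF lim[OF that] *(2)[OF _ that]])
qed

lemma matrix_class_a_hat:
  assumes pq: "inverse p + inverse q = 1" and A: "A \<in> matrix_class (lpF_space lam p) Y"
  shows "lp_norm q (a_hat lam A n) < \<infinity>"
    and "lp_norm p y < \<infinity> \<Longrightarrow> (\<lambda>n. \<Sum>k. a_hat lam A n k * y k) \<in> Y"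
    and "op_hausdorff_mnc (lpF_space lam p) (lpF_norm lam p) Y d (matrix_op A)
      = hausdorff_mnc Y d ((\<lambda>y n. \<Sum>k. a_hat lam A n k * y k) ` {y. lp_norm p y = 1})"
proof -
  have summ: "summable (\<lambda>k. A n k * x k)" if "x \<in> lpF_space lam p" for x n
    using A that by (simp add: matrix_class_def)
  have G: "matrix_op A (E_inv y) = (\<lambda>n. \<Sum>k. a_hat lam A n k * y k)" if "lp_norm p y < \<infinity>" for y
    by (rule ext, rule matrix_op_E_inv(2)[OF pq _ that], rule summ)
  show "lp_norm q (a_hat lam A n) < \<infinity>"
    by (rule matrix_op_E_inv(1)[OF pq], rule summ)
  show "(\<lambda>n. \<Sum>k. a_hat lam A n k * y k) \<in> Y" if "lp_norm p y < \<infinity>"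
    using A that E_inv_in_lpF[of y p] G[OF that] by (auto simp: matrix_class_def)
  have "{x \<in> lpF_space lam p. lpF_norm lam p x = 1} = E_inv ` {y. lp_norm p y = 1}"
  proof (intro equalityI subsetI)
    fix x assume "x \<in> {x \<in> lpF_space lam p. lpF_norm lam p x = 1}"
    then show "x \<in> E_inv ` {y. lp_norm p y = 1}"
      by (intro image_eqI[of _ _ "E_op lam x"]) (auto simp: E_inv_E_op lpF_norm_def)
  qed (auto simp: lpF_norm_def lpF_space_def lp_space_def E_op_E_inv)
  then have "matrix_op A ` {x \<in> lpF_space lam p. lpF_norm lam p x = 1}
      = (\<lambda>y. matrix_op A (E_inv y)) ` {y. lp_norm p y = 1}"
    by (simp only: image_image)
  also have "\<dots> = (\<lambda>y n. \<Sum>k. a_hat lam A n k * y k) ` {y. lp_norm p y = 1}"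
    by (intro image_cong refl) (simp add: G)
  finally have "matrix_op A ` {x \<in> lpF_space lam p. lpF_norm lam p x = 1}
      = (\<lambda>y n. \<Sum>k. a_hat lam A n k * y k) ` {y. lp_norm p y = 1}" .
  then show "op_hausdorff_mnc (lpF_space lam p) (lpF_norm lam p) Y d (matrix_op A)
      = hausdorff_mnc Y d ((\<lambda>y n. \<Sum>k. a_hat lam A n k * y k) ` {y. lp_norm p y = 1})"
    by (simp add: op_hausdorff_mnc_def)
qed

end

text \<open>Since the inverse of \<infinity> is 0 in the extended reals, the equation for p and q
  expresses conjugacy at the endpoints too. Each limit is stated as convergence, so its existence is
  part of the claim, as is the existence of the column limits \<alpha> in the last part.\<close>

theorem theorem6p16:
  fixes lam :: "nat \<Rightarrow> real" and A :: "nat \<Rightarrow> nat \<Rightarrow> real" and p q :: ennreal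
  assumes lam_mono: "strict_mono lam"
    and lam_pos: "\<And>k. 0 < lam k"
    and lam_lim: "filterlim lam at_top sequentially"
    and p: "1 \<le> p"
    and q: "inverse p + inverse q = 1"
  shows
    "(A \<in> matrix_class (lpF_space lam p) c0_space \<longrightarrow>
       (p = \<infinity> \<longrightarrow>
         (\<lambda>r. SUP n\<in>{r..}. \<Sum>k. ennreal \<bar>a_hat lam A n k\<bar>) \<longlonglongrightarrow>
         op_hausdorff_mnc (lpF_space lam p) (lpF_norm lam p) c0_space (lp_dist \<infinity>) (matrix_op A)) \<and>
       (1 < p \<and> p < \<infinity> \<longrightarrow>
         (\<lambda>r. SUP n\<in>{r..}. lp_norm q (a_hat lam A n)) \<longlonglongrightarrow>
         op_hausdorff_mnc (lpF_space lam p) (lpF_norm lam p) c0_space (lp_dist \<infinity>) (matrix_op A)) \<and>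
       (p = 1 \<longrightarrow>
         (\<lambda>r. SUP n\<in>{r..}. SUP k. ennreal \<bar>a_hat lam A n k\<bar>) \<longlonglongrightarrow>
         op_hausdorff_mnc (lpF_space lam p) (lpF_norm lam p) c0_space (lp_dist \<infinity>) (matrix_op A)))
     \<and>
     (A \<in> matrix_class (lpF_space lam p) (lp_space 1) \<longrightarrow>
       (1 < p \<longrightarrow>
         (\<exists>l. (\<lambda>r. SUP N\<in>{N. finite N \<and> N \<subseteq> {r..}}. lp_norm q (\<lambda>k. \<Sum>n\<in>N. a_hat lam A n k)) \<longlonglongrightarrow> l \<and>
           l \<le> op_hausdorff_mnc (lpF_space lam p) (lpF_norm lam p) (lp_space 1) (lp_dist 1) (matrix_op A) \<and>
           op_hausdorff_mnc (lpF_space lam p) (lpF_norm lam p) (lp_space 1) (lp_dist 1) (matrix_op A) \<le> 4 * l)) \<and>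
       (p = 1 \<longrightarrow>
         (\<lambda>r. SUP k. \<Sum>n. ennreal \<bar>a_hat lam A (n + r) k\<bar>) \<longlonglongrightarrow>
         op_hausdorff_mnc (lpF_space lam p) (lpF_norm lam p) (lp_space 1) (lp_dist 1) (matrix_op A)))
     \<and>
     (A \<in> matrix_class (lpF_space lam p) c_space \<longrightarrow>
       (\<exists>\<alpha> l. (\<forall>k. (\<lambda>n. a_hat lam A n k) \<longlonglongrightarrow> \<alpha> k) \<and>
         (\<lambda>r. SUP n\<in>{r..}. lp_norm q (\<lambda>k. a_hat lam A n k - \<alpha> k)) \<longlonglongrightarrow> l \<and>
         l / 2 \<le> op_hausdorff_mnc (lpF_space lam p) (lpF_norm lam p) c_space (lp_dist \<infinity>) (matrix_op A) \<and>
         op_hausdorff_mnc (lpF_space lam p) (lpF_norm lam p) c_space (lp_dist \<infinity>) (matrix_op A) \<le> l))"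
proof -
  interpret lambda_sequence lam
    by unfold_locales (fact lam_mono lam_pos lam_lim)+
  note cls = matrix_class_a_hat[OF q, of A]
  have q_infinity: "q = 1" if "p = \<infinity>"
    using q that by (cases rule: conj_exp_cases) auto
  have q_one: "q = \<infinity>" if "p = 1"
    using q that by (cases rule: conj_exp_cases) (auto simp: ennreal_eq_1)
  have c0: "(\<lambda>r. SUP n\<in>{r..}. lp_norm q (a_hat lam A n)) \<longlonglongrightarrow>
      op_hausdorff_mnc (lpF_space lam p) (lpF_norm lam p) c0_space (lp_dist \<infinity>) (matrix_op A)"
    if "A \<in> matrix_class (lpF_space lam p) c0_space"
    unfolding cls(3)[OF that]
    by (rule hausdorff_mnc_matrix_c0[OF q cls(1)[OF that] cls(2)[OF that]]) simp_all
  have l1: "\<exists>l. (\<lambda>r. SUP N\<in>{N. finite N \<and> N \<subseteq> {r..}}. lp_norm q (\<lambda>k. \<Sum>n\<in>N. a_hat lam A n k)) \<longlonglongrightarrow> l \<and>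
      l \<le> op_hausdorff_mnc (lpF_space lam p) (lpF_norm lam p) (lp_space 1) (lp_dist 1) (matrix_op A) \<and>
      op_hausdorff_mnc (lpF_space lam p) (lpF_norm lam p) (lp_space 1) (lp_dist 1) (matrix_op A) \<le> 4 * l"
    if A: "A \<in> matrix_class (lpF_space lam p) (lp_space 1)"
  proof -
    have "\<exists>l. (\<lambda>r. SUP N\<in>{N. finite N \<and> N \<subseteq> {r..}}. lp_norm q (\<lambda>k. \<Sum>n\<in>N. a_hat lam A n k)) \<longlonglongrightarrow> l \<and>
        l \<le> op_hausdorff_mnc (lpF_space lam p) (lpF_norm lam p) (lp_space 1) (lp_dist 1) (matrix_op A) \<and>
        op_hausdorff_mnc (lpF_space lam p) (lpF_norm lam p) (lp_space 1) (lp_dist 1) (matrix_op A) \<le> 2 * l"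
      unfolding cls(3)[OF A]
      by (rule hausdorff_mnc_matrix_l1[OF q cls(1)[OF A] cls(2)[OF A]]) simp_all
    \<comment> \<open>The constant 2 comes from splitting real sums by sign; it is relaxed here to
      the stated 4.\<close>
    moreover have "2 * l \<le> 4 * l" for l :: ennreal by (intro mult_right_mono) auto
    ultimately show ?thesis by (meson order_trans)
  qed
  have l1_one: "(\<lambda>r. SUP k. \<Sum>n. ennreal \<bar>a_hat lam A (n + r) k\<bar>) \<longlonglongrightarrow>
      op_hausdorff_mnc (lpF_space lam p) (lpF_norm lam p) (lp_space 1) (lp_dist 1) (matrix_op A)"
    if A: "A \<in> matrix_class (lpF_space lam p) (lp_space 1)" and "p = 1"
    unfolding cls(3)[OF A] unfolding \<open>p = 1\<close>
    using cls(1,2)[OF A] q_one \<open>p = 1\<close> by (intro hausdorff_mnc_matrix_l1_one) simp_all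
  have c: "\<exists>\<alpha> l. (\<forall>k. (\<lambda>n. a_hat lam A n k) \<longlonglongrightarrow> \<alpha> k) \<and>
      (\<lambda>r. SUP n\<in>{r..}. lp_norm q (\<lambda>k. a_hat lam A n k - \<alpha> k)) \<longlonglongrightarrow> l \<and>
      l / 2 \<le> op_hausdorff_mnc (lpF_space lam p) (lpF_norm lam p) c_space (lp_dist \<infinity>) (matrix_op A) \<and>
      op_hausdorff_mnc (lpF_space lam p) (lpF_norm lam p) c_space (lp_dist \<infinity>) (matrix_op A) \<le> l"
    if "A \<in> matrix_class (lpF_space lam p) c_space"
    unfolding cls(3)[OF that]
    by (rule hausdorff_mnc_matrix_c[OF q cls(1)[OF that] cls(2)[OF that]])
  show ?thesis
  proof (intro conjI impI)
    assume A: "A \<in> matrix_class (lpF_space lam p) c0_space"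
    show "(\<lambda>r. SUP n\<in>{r..}. \<Sum>k. ennreal \<bar>a_hat lam A n k\<bar>) \<longlonglongrightarrow>
        op_hausdorff_mnc (lpF_space lam p) (lpF_norm lam p) c0_space (lp_dist \<infinity>) (matrix_op A)"
      if "p = \<infinity>" using c0[OF A] unfolding q_infinity[OF that] lp_norm_1_eq .
    show "(\<lambda>r. SUP n\<in>{r..}. SUP k. ennreal \<bar>a_hat lam A n k\<bar>) \<longlonglongrightarrow>
        op_hausdorff_mnc (lpF_space lam p) (lpF_norm lam p) c0_space (lp_dist \<infinity>) (matrix_op A)"
      if "p = 1" using c0[OF A] unfolding q_one[OF that] by (simp add: lp_norm_def)
  qed (use c0 l1 l1_one c in blast)+
qed

end
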